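(* Let $\lambda$ and $\partial$ be infinite cardinals such that: (a) $\lambda = \partial^+$; (b) $\partial = \mathrm{cf}(\partial) > \aleph_0$ (i.e. $\partial$ is a regular uncountable cardinal); (c) there is a stationary subset $W$ of $\lambda$ consisting of ordinals of cofinality $< \partial$ which reflects in no ordinal $< \lambda$. Then $\Pr_1(\lambda,\lambda,\partial,\partial)$ holds, and moreover $\Pr_1(\lambda,\lambda,\lambda,\partial)$ holds.
   Context: Definition of $\Pr_1$. Let $\lambda,\mu,\theta_0,\theta_1$ be infinite cardinals and $\sigma$ a (finite or infinite) cardinal with $\lambda \ge \mu \ge \sigma + \theta_0 + \theta_1$. Then $\Pr_1(\lambda,\mu,\sigma,(\theta_0,\theta_1))$ means that there is a function $\mathbf c : [\lambda]^2 \to \sigma$ (where $[\lambda]^2$ is the set of two-element subsets of $\lambda$) with the following property: whenever - for $\iota = 0,1$, $\mathbf i_\iota < \theta_\iota$ is an ordinal and $\bar\zeta^\iota = \langle \zeta^\iota_{\alpha,i} : \alpha < \mu,\ i < \mathbf i_\iota\rangle$ is a sequence of ordinals $< \lambda$ without repetitions (i.e. $(\alpha,i)\mapsto \zeta^\iota_{\alpha,i}$ is injective), - the ranges of $\bar\zeta^0$ and $\bar\zeta^1$ are disjoint, and - $\gamma < \sigma$, there are $\alpha_0 < \alpha_1 < \mu$ such that for all $i_0 < \mathbf i_0$ and all $i_1 < \mathbf i_1$ we have $\mathbf c\{\zeta^0_{\alpha_0,i_0},\zeta^1_{\alpha_1,i_1}\} = \gamma$ and $\zeta^0_{\alpha_0,i_0}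 < \zeta^1_{\alpha_1,i_1}$. When $\theta_0 = \theta_1 = \theta$, one writes $\Pr_1(\lambda,\mu,\sigma,\theta)$ for $\Pr_1(\lambda,\mu,\sigma,(\theta,\theta))$. As usual, a set $W \subseteq \lambda$ reflects in an ordinal $\delta < \lambda$ if $\delta$ is a limit ordinal of uncountable cofinality and $W \cap \delta$ is stationary in $\delta$. *)

theory Defs
  imports Complex_Main "HOL-Library.FuncSet" "HOL-Library.Ramsey"
begin

unbundle cardinal_syntax

text \<open>
  Ordinals are well-orders in the sense of \<^const>\<open>Well_order\<close>, cardinals are well-orders
  satisfying \<^const>\<open>Card_order\<close>.  The ordinals below \<open>r\<close> are the elements of \<^term>\<open>Field r\<close>;
  such an element \<open>\<delta>\<close>, regarded as the set of smaller ordinals, is \<^term>\<open>underS r \<delta>\<close>, and as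
  a well-order in its own right it is \<open>seg r \<delta>\<close>.
\<close>

definition seg :: "'a rel \<Rightarrow> 'a \<Rightarrow> 'a rel" where
  "seg r \<delta> = Restr r (underS r \<delta>)"

definition unbounded :: "'a rel \<Rightarrow> 'a set \<Rightarrow> bool" where
  "unbounded r A \<longleftrightarrow> A \<subseteq> Field r \<and> (\<forall>a\<in>Field r. \<exists>b\<in>A. (a, b) \<in> r)"

text \<open>
  The library's \<^const>\<open>cofinal\<close> asks for strictly larger elements, so that successor ordinals
  have no cofinal subset at all; with the weak order used in \<open>unbounded\<close>, the cofinality of
  \<open>0\<close> is \<open>0\<close> and that of a successor is \<open>1\<close>, as usual.
\<close>

definition cofinality :: "'a rel \<Rightarrow> 'a rel" where
  "cofinality r = |SOME A. unbounded r A \<and> (\<forall>B. unbounded r B \<longrightarrow> |A| \<le>o |B| )|"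

lemma cofinality_attained: "\<exists>A. unbounded r A \<and> cofinality r = |A|"
  and cofinality_least: "unbounded r B \<Longrightarrow> cofinality r \<le>o |B|"
  if "Well_order r"
proof -
  have "unbounded r (Field r)"
    using that by (auto simp: unbounded_def order_on_defs refl_on_def)
  then have "\<exists>k\<in>card_of ` {A. unbounded r A}. \<forall>k'\<in>card_of ` {A. unbounded r A}. k \<le>o k'"
    by (intro exists_minim_Card_order) (auto simp: card_of_Card_order)
  then have "\<exists>A. unbounded r A \<and> (\<forall>B. unbounded r B \<longrightarrow> |A| \<le>o |B| )"
    by auto
  from someI_ex[OF this]
  show "\<exists>A. unbounded r A \<and> cofinality r = |A|"
    and "unbounded r B \<Longrightarrow> cofinality r \<le>o |B|"
    unfolding cofinality_def by blast+
qed

definition limit_ordinal :: "'a rel \<Rightarrow> bool" where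
  "limit_ordinal r \<longleftrightarrow>
     Well_order r \<and> Field r \<noteq> {} \<and> (\<forall>a\<in>Field r. \<exists>b\<in>Field r. a \<in> underS r b)"

definition club :: "'a rel \<Rightarrow> 'a set \<Rightarrow> bool" where
  "club r C \<longleftrightarrow> unbounded r C \<and>
     (\<forall>\<delta>\<in>Field r. limit_ordinal (seg r \<delta>) \<and> unbounded (seg r \<delta>) (C \<inter> underS r \<delta>) \<longrightarrow> \<delta> \<in> C)"

definition stationary :: "'a rel \<Rightarrow> 'a set \<Rightarrow> bool" where
  "stationary r S \<longleftrightarrow> S \<subseteq> Field r \<and> (\<forall>C. club r C \<longrightarrow> S \<inter> C \<noteq> {})"

definition reflects_in :: "'a rel \<Rightarrow> 'a set \<Rightarrow> 'a \<Rightarrow> bool" where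
  "reflects_in r W \<delta> \<longleftrightarrow>
     limit_ordinal (seg r \<delta>) \<and> natLeq <o cofinality (seg r \<delta>) \<and>
     stationary (seg r \<delta>) (W \<inter> underS r \<delta>)"

text \<open>
  \<open>Pr1_pair \<lambda> \<mu> \<sigma> \<theta>\<^sub>0 \<theta>\<^sub>1\<close> is the relation \<open>Pr\<^sub>1(\<lambda>, \<mu>, \<sigma>, (\<theta>\<^sub>0, \<theta>\<^sub>1))\<close>.  It is
  meant for infinite cardinals \<open>\<lambda>\<close>, \<open>\<mu>\<close>, \<open>\<theta>\<^sub>0\<close>, \<open>\<theta>\<^sub>1\<close> and a cardinal \<open>\<sigma>\<close> with
  \<open>\<lambda> \<ge> \<mu> \<ge> \<sigma> + \<theta>\<^sub>0 + \<theta>\<^sub>1\<close>.  Cardinals may live on different types.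
\<close>

definition Pr1_pair ::
    "'a rel \<Rightarrow> 'b rel \<Rightarrow> 'c rel \<Rightarrow> 'd rel \<Rightarrow> 'e rel \<Rightarrow> bool" where
  "Pr1_pair lam mu sig th0 th1 \<longleftrightarrow>
     (\<exists>c \<in> nsets (Field lam) 2 \<rightarrow> Field sig.
        \<forall>i0\<in>Field th0. \<forall>i1\<in>Field th1. \<forall>(\<zeta>0 :: 'b \<times> 'd \<Rightarrow> 'a) (\<zeta>1 :: 'b \<times> 'e \<Rightarrow> 'a). \<forall>\<gamma>\<in>Field sig.
          \<zeta>0 \<in> Field mu \<times> underS th0 i0 \<rightarrow> Field lam \<and>
          \<zeta>1 \<in> Field mu \<times> underS th1 i1 \<rightarrow> Field lam \<and>
          inj_on \<zeta>0 (Field mu \<times> underS th0 i0) \<and>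
          inj_on \<zeta>1 (Field mu \<times> underS th1 i1) \<and>
          \<zeta>0 ` (Field mu \<times> underS th0 i0) \<inter> \<zeta>1 ` (Field mu \<times> underS th1 i1) = {}
          \<longrightarrow> (\<exists>\<alpha>1\<in>Field mu. \<exists>\<alpha>0\<in>underS mu \<alpha>1.
                \<forall>j0\<in>underS th0 i0. \<forall>j1\<in>underS th1 i1.
                  c {\<zeta>0 (\<alpha>0, j0), \<zeta>1 (\<alpha>1, j1)} = \<gamma> \<and>
                  \<zeta>0 (\<alpha>0, j0) \<in> underS lam (\<zeta>1 (\<alpha>1, j1))))"

abbreviation Pr1 :: "'a rel \<Rightarrow> 'b rel \<Rightarrow> 'c rel \<Rightarrow> 'd rel \<Rightarrow> bool" where
  "Pr1 lam mu sig th \<equiv> Pr1_pair lam mu sig th th"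

end

theory Submission
  imports Defs
begin

text \<open>
  Write \<open>\<lambda>\<close> for \<open>lam\<close> and \<open>\<partial>\<close> for \<open>par\<close>. The colouring comes from walks on ordinals. Every
  nonzero \<open>b < \<lambda>\<close> carries a ladder \<open>f b\<close>, a family of ordinals below \<open>b\<close>, indexed by \<open>\<partial>\<close> and cofinal in
  \<open>b\<close>. The walk from \<open>b\<close> down to \<open>a < b\<close> goes from a node \<open>v\<close> to \<open>f v i\<close>, where \<open>i < \<partial>\<close> is least
  with \<open>a \<le> f v i\<close>; this \<open>i\<close> is the weight of \<open>v\<close> towards \<open>a\<close>. Since \<open>W\<close> does not reflect, the
  ladders can be chosen so that no limit ordinal \<open>x \<in> W\<close> is an accumulation point of a ladder
  attached to an ordinal above \<open>x\<close>. Then such an \<open>x\<close> is \<^emph>\<open>forced\<close>: the walks from a fixed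
  \<open>b > x\<close> to all \<open>a < x\<close> close to \<open>x\<close> first go to \<open>x\<close>, with the same weights. Ordinals of
  cofinality \<open>\<partial>\<close> are forced too, because fewer than \<open>\<partial>\<close> ladder points are inspected before a step.

  Take two families \<open>a\<close>, \<open>b\<close> of sets of size \<open>< \<partial>\<close> that climb up \<open>\<lambda>\<close>, and a stationary set \<open>X\<close> of
  ordinals of cofinality \<open>\<partial>\<close>. The walks that matter pass through two forced ordinals,
  \<open>b d \<longrightarrow> d \<longrightarrow> x \<longrightarrow> a \<xi>\<close> with \<open>d \<in> X\<close> and \<open>x \<in> W\<close>.

  \<^item> \<^emph>\<open>Bottom.\<close> As \<open>cf x < \<partial>\<close>, cofinally many \<open>\<xi> < x\<close> can be handled at once: the weights on the
    walks from \<open>x\<close> to the elements of these \<open>a \<xi>\<close> have a bound below \<open>\<partial>\<close>. By the pigeonhole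
    principle one bound \<open>i\<close> serves unboundedly many \<open>x \<in> W\<close> (\<open>uniform_bottom_bound\<close>), and \<open>i\<close> is
    found before \<open>d\<close> is chosen. Here the assumption that \<open>W\<close> consists of ordinals of cofinality
    \<open>< \<partial>\<close> is used.
  \<^item> \<^emph>\<open>Top.\<close> Choose \<open>d \<in> X\<close> among the limits of these \<open>x\<close>. As \<open>b d\<close> has fewer than \<open>\<partial>\<close> elements,
    the weights on the walks from \<open>b d\<close> to \<open>d\<close> have a bound below \<open>\<partial>\<close> too.
  \<^item> \<^emph>\<open>Middle.\<close> Since \<open>cf d = \<partial>\<close>, the weight of \<open>d\<close> towards \<open>x\<close> tends to \<open>\<partial>\<close> as \<open>x\<close> tends to \<open>d\<close>,
    so it exceeds both bounds for \<open>x\<close> close to \<open>d\<close>.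

  Hence the first maximal weight on the whole walk occurs in the middle part from \<open>d\<close> to \<open>x\<close>, which
  is the same for all pairs in \<open>a \<xi> \<times> b d\<close>; so \<open>d\<close> lies some number \<open>n\<close> of nodes above the first
  peak, with one \<open>n\<close> for all these pairs (\<open>node_above_peak_hits\<close>).

  The number \<open>n\<close> still depends on the families, but \<open>\<partial>\<close> is regular and uncountable. Were each
  \<open>n < \<omega>\<close> refuted for \<open>X\<close> by its own pair of families, the countable unions of these families would
  refute all \<open>n\<close> at once; so for each \<open>X\<close> one \<open>n\<close> works for all families (\<open>uniform_hits\<close>).
  Finally, an Ulam matrix gives \<open>\<lambda>\<close> many stationary sets, each with an index in \<open>\<partial> \<times> \<omega>\<close> formed by
  its row and its \<open>n\<close>. As \<open>\<partial> < \<lambda>\<close>, \<open>\<lambda>\<close> many of them share both; these are pairwise disjoint, and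
  the colour of \<open>{u, v}\<close> tells which of them contains the \<open>n\<close>-th node above the first peak of
  the walk from \<open>v\<close> to \<open>u\<close> (\<open>strong_colouring\<close>).
\<close>

section \<open>The order and the cardinal arithmetic of a successor of a regular cardinal\<close>

locale successor_of_regular =
  fixes lam :: "'a rel" and par :: "'b rel"
  assumes lam_inf: "Cinfinite lam" and par_inf: "Cinfinite par"
    and lam_succ: "lam =o cardSuc par"
    and par_reg: "regularCard par" and par_unc: "natLeq <o par"
begin

abbreviation less_lam (infix "\<sqsubset>" 50) where "x \<sqsubset> y \<equiv> x \<in> underS lam y"
abbreviation leq_lam (infix "\<sqsubseteq>" 50) where "x \<sqsubseteq> y \<equiv> (x, y) \<in> lam"

lemma wo: "Well_order lam" and wo_par: "Well_order par"
  using lam_inf par_inf by (auto dest: card_order_on_well_order_on)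

lemma Card_lam: "Card_order lam" and Card_par: "Card_order par"
  using lam_inf par_inf by auto

lemma wor: "wo_rel lam" and wor_par: "wo_rel par"
  using wo wo_par by (auto simp: wo_rel_def)

lemma less_Field: "x \<sqsubset> y \<Longrightarrow> x \<in> Field lam \<and> y \<in> Field lam"
  by (auto simp: underS_def Field_def)

lemma less_Field1: "x \<sqsubset> y \<Longrightarrow> x \<in> Field lam" and less_Field2: "x \<sqsubset> y \<Longrightarrow> y \<in> Field lam"
  using less_Field by blast+

lemma leq_Field: "x \<sqsubseteq> y \<Longrightarrow> x \<in> Field lam \<and> y \<in> Field lam"
  by (auto simp: Field_def)

lemma leq_refl: "x \<in> Field lam \<Longrightarrow> x \<sqsubseteq> x"
  using wor by (meson wo_rel.REFL refl_on_def)

lemma less_leq: "x \<sqsubset> y \<Longrightarrow> x \<sqsubseteq> y"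
  by (auto simp: underS_def)

lemma less_irrefl: "\<not> x \<sqsubset> x"
  by (auto simp: underS_def)

lemma leq_trans: "x \<sqsubseteq> y \<Longrightarrow> y \<sqsubseteq> z \<Longrightarrow> x \<sqsubseteq> z"
  using wor by (meson wo_rel.TRANS transD)

lemma leq_antisym: "x \<sqsubseteq> y \<Longrightarrow> y \<sqsubseteq> x \<Longrightarrow> x = y"
  using wor by (meson wo_rel.ANTISYM antisymD)

lemma leq_less_trans: "x \<sqsubseteq> y \<Longrightarrow> y \<sqsubset> z \<Longrightarrow> x \<sqsubset> z"
  by (smt (verit, best) leq_antisym leq_trans mem_Collect_eq underS_def)

lemma less_leq_trans: "x \<sqsubset> y \<Longrightarrow> y \<sqsubseteq> z \<Longrightarrow> x \<sqsubset> z"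
  by (smt (verit, best) leq_antisym leq_trans mem_Collect_eq underS_def)

lemma less_trans: "x \<sqsubset> y \<Longrightarrow> y \<sqsubset> z \<Longrightarrow> x \<sqsubset> z"
  using leq_less_trans less_leq by blast

lemma not_less: "x \<in> Field lam \<Longrightarrow> y \<in> Field lam \<Longrightarrow> \<not> x \<sqsubset> y \<longleftrightarrow> y \<sqsubseteq> x"
  by (metis (mono_tags, lifting) leq_antisym leq_less_trans less_irrefl mem_Collect_eq
      underS_def wo_rel.TOTALS wor)

lemma leq_iff: "x \<in> Field lam \<Longrightarrow> x \<sqsubseteq> y \<longleftrightarrow> x \<sqsubset> y \<or> x = y"
  by (auto simp: underS_def leq_refl)

lemma less_induct [consumes 1, case_names less]:
  assumes "x \<in> Field lam"
    and "\<And>x. x \<in> Field lam \<Longrightarrow> (\<And>y. y \<sqsubset> x \<Longrightarrow> P y) \<Longrightarrow> P x"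
  shows "P x"
proof -
  have "x \<in> Field lam \<longrightarrow> P x"
    by (rule wo_rel.well_order_induct[OF wor])
      (use assms(2) in \<open>metis (mono_tags, lifting) less_Field mem_Collect_eq underS_def\<close>)
  then show ?thesis using assms(1) by simp
qed

lemma ex_least:
  assumes "A \<subseteq> Field lam" "A \<noteq> {}"
  shows "\<exists>m\<in>A. \<forall>a\<in>A. m \<sqsubseteq> a"
  using wo_rel.minim_in[OF wor assms] wo_rel.minim_least[OF wor assms(1)] by blast

lemma ex_greater: "x \<in> Field lam \<Longrightarrow> \<exists>y. x \<sqsubset> y"
  using infinite_Card_order_limit[OF Card_lam] lam_inf
  by (fastforce simp: underS_def cinfinite_def)

lemma segment_small: "x \<in> Field lam \<Longrightarrow> |underS lam x| \<le>o par"
proof -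
  assume "x \<in> Field lam"
  then have "|underS lam x| <o lam" by (rule card_of_underS[OF Card_lam])
  then have "|underS lam x| <o cardSuc par" using lam_succ ordLess_ordIso_trans by blast
  then show ?thesis by (simp add: Card_par cardSuc_ordLeq_ordLess card_of_Card_order)
qed

lemma lam_reg: "regularCard lam"
proof -
  have "regularCard (cardSuc par)"
    using par_inf infinite_cardSuc_regularCard by (auto simp: cinfinite_def)
  moreover have "Cinfinite (cardSuc par)" using par_inf by (simp add: Cinfinite_cardSuc)
  ultimately show ?thesis
    using regularCard_ordIso[OF ordIso_symmetric[OF lam_succ]] by blast
qed

lemma par_less_lam: "par <o lam"
  using cardSuc_greater[OF Card_par] lam_succ ordIso_symmetric ordLess_ordIso_trans by blast

lemma bounded_lam:
  assumes "A \<subseteq> Field lam" "|A| \<le>o par"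
  shows "\<exists>b. b \<in> Field lam \<and> (\<forall>a\<in>A. a \<sqsubset> b)"
proof -
  have "\<not> |A| =o lam"
    using assms(2) par_less_lam not_ordLess_ordIso ordLeq_ordLess_trans by blast
  then have "\<not> cofinal A lam" using lam_reg assms(1) by (auto simp: regularCard_def)
  then obtain b where b: "b \<in> Field lam" "\<And>a. a \<in> A \<Longrightarrow> \<not> (b \<noteq> a \<and> b \<sqsubseteq> a)"
    by (auto simp: cofinal_def)
  obtain c where "b \<sqsubset> c" using ex_greater b by blast
  moreover have "a \<sqsubseteq> b" if "a \<in> A" for a
  proof -
    have "\<not> b \<sqsubset> a" using b(2)[OF that] by (auto simp: underS_def)
    then show ?thesis using not_less[of b a] b(1) that assms(1) by blast
  qed
  ultimately show ?thesis using leq_less_trans less_Field by blast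
qed

lemma bounded_par:
  assumes "A \<subseteq> Field par" "|A| <o par"
  shows "\<exists>b\<in>Field par. \<forall>a\<in>A. a \<in> underS par b"
proof -
  have "\<not> |A| =o par" using assms(2) not_ordLess_ordIso by blast
  then have "\<not> cofinal A par" using par_reg assms(1) by (auto simp: regularCard_def)
  then obtain b where b: "b \<in> Field par" "\<And>a. a \<in> A \<Longrightarrow> \<not> (b \<noteq> a \<and> (b, a) \<in> par)"
    by (auto simp: cofinal_def)
  obtain c where c: "c \<in> Field par" "b \<noteq> c" "(b, c) \<in> par"
    using infinite_Card_order_limit[OF Card_par _ b(1)] par_inf by (auto simp: cinfinite_def)
  have "a \<in> underS par c" if "a \<in> A" for a
  proof -
    have "(a, b) \<in> par"
      using wo_rel.TOTALS[OF wor_par] b(1) b(2)[OF that] that assms(1)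
        wo_rel.REFL[OF wor_par] by (auto simp: refl_on_def)
    then show ?thesis using c
      using wo_rel.TRANS[OF wor_par] wo_rel.ANTISYM[OF wor_par]
      by (auto simp: underS_def trans_def antisym_def)
  qed
  then show ?thesis using c by blast
qed

lemma small_UNION:
  assumes "|I| <o par" "\<And>i. i \<in> I \<Longrightarrow> |A i| <o par"
  shows "|\<Union>i\<in>I. A i| <o par"
proof -
  have "stable par"
    using regularCard_stable par_reg par_inf by (auto simp: cinfinite_def)
  then show ?thesis by (rule stable_UNION) (use assms in auto)
qed

lemma small_countable: "|A::nat set| <o par"
proof -
  have "|A| \<le>o natLeq"
    using card_of_nat card_of_mono1[of A UNIV] ordLeq_ordIso_trans by blast
  then show ?thesis using par_unc ordLeq_ordLess_trans by blast
qed

lemma small_finite: "finite A \<Longrightarrow> |A| <o par"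
  using finite_ordLess_infinite[OF card_of_Well_order wo_par, of A] par_inf
  by (auto simp: cinfinite_def Field_card_of)

lemma small_image: "|A| <o par \<Longrightarrow> |g ` A| <o par"
  by (rule ordLeq_ordLess_trans[OF card_of_image])

lemma image_le_par: "|A| \<le>o par \<Longrightarrow> |g ` A| \<le>o par"
  by (rule ordLeq_transitive[OF card_of_image])

lemma bounded_image:
  assumes "|I| \<le>o par" and "\<And>i. i \<in> I \<Longrightarrow> g i \<in> Field lam"
  shows "\<exists>b\<in>Field lam. \<forall>i\<in>I. g i \<sqsubset> b"
proof -
  have "g ` I \<subseteq> Field lam" using assms(2) by (rule image_subsetI)
  from bounded_lam[OF this image_le_par[OF assms(1)]] show ?thesis by (simp add: Bex_def)
qed

lemma underS_par_Field: "j \<in> underS par i \<Longrightarrow> j \<in> Field par"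
  by (auto simp: underS_def Field_def)

lemma par_refl: "i \<in> Field par \<Longrightarrow> (i, i) \<in> par"
  using wo_rel.REFL[OF wor_par] by (auto simp: refl_on_def)

lemma par_trans: "(i, j) \<in> par \<Longrightarrow> (j, k) \<in> par \<Longrightarrow> (i, k) \<in> par"
  using wo_rel.TRANS[OF wor_par] by (auto simp: trans_def)

lemma par_less_trans: "i \<in> underS par j \<Longrightarrow> (j, k) \<in> par \<Longrightarrow> i \<in> underS par k"
  using wo_rel.TRANS[OF wor_par] wo_rel.ANTISYM[OF wor_par]
  by (auto simp: underS_def trans_def antisym_def)

lemma ex_max_par: "finite A \<Longrightarrow> A \<noteq> {} \<Longrightarrow> A \<subseteq> Field par \<Longrightarrow> \<exists>m\<in>A. \<forall>a\<in>A. (a, m) \<in> par"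
proof (induction rule: finite_ne_induct)
  case (singleton a)
  then show ?case using par_refl by simp
next
  case (insert a A)
  then obtain m where m: "m \<in> A" "\<forall>a\<in>A. (a, m) \<in> par" by blast
  show ?case
  proof (cases "(a, m) \<in> par")
    case True
    then show ?thesis using m by blast
  next
    case False
    then have "(m, a) \<in> par" using wo_rel.TOTALS[OF wor_par] insert.prems m(1) by blast
    then have "\<forall>c\<in>insert a A. (c, a) \<in> par"
      using m(2) par_trans[of _ m a] par_refl[of a] insert.prems by blast
    then show ?thesis by blast
  qed
qed

lemma small_segment_par: "i \<in> Field par \<Longrightarrow> |underS par i| <o par"
  by (rule card_of_underS[OF Card_par])


section \<open>Limits, closed unbounded and stationary sets\<close>

definition limit where
  "limit x \<longleftrightarrow> x \<in> Field lam \<and> underS lam x \<noteq> {} \<and> (\<forall>a. a \<sqsubset> x \<longrightarrow> (\<exists>b. a \<sqsubset> b \<and> b \<sqsubset> x))"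

text \<open>
  For limit ordinals \<open>x < \<lambda>\<close> this says \<open>cf x = \<partial>\<close>; cofinalities above \<open>\<partial>\<close> do not occur below
  \<open>\<lambda> = \<partial>\<^sup>+\<close>.
\<close>

definition cof_par where
  "cof_par x \<longleftrightarrow> limit x \<and>
     (\<forall>A. A \<subseteq> underS lam x \<longrightarrow> |A| <o par \<longrightarrow> (\<exists>e. e \<sqsubset> x \<and> (\<forall>a\<in>A. a \<sqsubseteq> e)))"

lemma cof_par_bounds_image:
  assumes "cof_par x" "|I| <o par" "\<And>i. i \<in> I \<Longrightarrow> g i \<sqsubset> x"
  shows "\<exists>e. e \<sqsubset> x \<and> (\<forall>i\<in>I. g i \<sqsubseteq> e)"
proof -
  have "g ` I \<subseteq> underS lam x" using assms(3) by blast
  from assms(1)[unfolded cof_par_def, THEN conjunct2, rule_format, OF this small_image[OF assms(2)]]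
  show ?thesis by simp
qed

lemma seg_iff: "(a, b) \<in> seg lam x \<longleftrightarrow> a \<sqsubset> x \<and> b \<sqsubset> x \<and> a \<sqsubseteq> b"
  by (auto simp: seg_def)

lemma Field_seg: "Field (seg lam x) = underS lam x"
proof
  show "Field (seg lam x) \<subseteq> underS lam x" by (auto simp: Field_def seg_iff)
  show "underS lam x \<subseteq> Field (seg lam x)"
  proof
    fix a assume "a \<sqsubset> x"
    then have "(a, a) \<in> seg lam x" using less_Field leq_refl by (auto simp: seg_iff)
    then show "a \<in> Field (seg lam x)" by (auto simp: Field_def)
  qed
qed

lemma underS_seg: "y \<sqsubset> x \<Longrightarrow> underS (seg lam x) y = underS lam y"
proof -
  assume y: "y \<sqsubset> x"
  have "a \<in> underS (seg lam x) y \<longleftrightarrow> a \<sqsubset> y" for a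
  proof -
    have "a \<in> underS (seg lam x) y \<longleftrightarrow> a \<sqsubset> x \<and> a \<sqsubset> y"
      using y by (auto simp: underS_def[of "seg lam x"] underS_def[of lam y] seg_iff)
    then show ?thesis using less_trans[OF _ y] by blast
  qed
  then show ?thesis by blast
qed

lemma seg_seg: "y \<sqsubset> x \<Longrightarrow> seg (seg lam x) y = seg lam y"
proof -
  assume y: "y \<sqsubset> x"
  have "p \<in> seg (seg lam x) y \<longleftrightarrow> p \<in> seg lam y" for p
    using less_trans[OF _ y]
    by (cases p) (auto simp: seg_def[of "seg lam x"] underS_seg[OF y] seg_iff)
  then show ?thesis by blast
qed

lemma limit_ordinal_seg: "x \<in> Field lam \<Longrightarrow> limit_ordinal (seg lam x) \<longleftrightarrow> limit x"
proof -
  assume x: "x \<in> Field lam"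
  have "Well_order (seg lam x)" unfolding seg_def by (rule Well_order_Restr[OF wo])
  moreover have "(\<exists>b\<in>underS lam x. a \<in> underS (seg lam x) b) \<longleftrightarrow> (\<exists>b. a \<sqsubset> b \<and> b \<sqsubset> x)" for a
    using underS_seg[of _ x] by blast
  ultimately show ?thesis using x
    unfolding limit_ordinal_def limit_def Field_seg by (simp add: Ball_def)
qed

lemma unbounded_seg:
  "unbounded (seg lam x) A \<longleftrightarrow> A \<subseteq> underS lam x \<and> (\<forall>a. a \<sqsubset> x \<longrightarrow> (\<exists>b\<in>A. a \<sqsubseteq> b))"
  unfolding unbounded_def Field_seg seg_iff by (rule conj_cong) (simp, blast)

lemma limit_bounds_finite:
  assumes "limit x" "finite A" "A \<subseteq> underS lam x"
  shows "\<exists>e. e \<sqsubset> x \<and> (\<forall>a\<in>A. a \<sqsubseteq> e)"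
  using assms(2,3)
proof (induction A)
  case empty
  then show ?case using assms(1) by (auto simp: limit_def)
next
  case (insert a A)
  then obtain e where e: "e \<sqsubset> x" "\<forall>a\<in>A. a \<sqsubseteq> e" by auto
  have a: "a \<sqsubset> x" using insert by simp
  show ?case
  proof (cases "a \<sqsubset> e")
    case True
    then show ?thesis using e less_leq by auto
  next
    case False
    then have "e \<sqsubseteq> a" using not_less[of a e] less_Field[OF a] less_Field[OF e(1)] by blast
    then have "\<forall>c\<in>insert a A. c \<sqsubseteq> a"
      using e leq_trans[of _ e a] leq_refl less_Field[OF a] by blast
    then show ?thesis using a by blast
  qed
qed

text \<open>
  This is the only construction of clubs that is needed: limits of unbounded sets, intersections of
  \<open>\<partial>\<close> many clubs and closure under a family of sets all arise from a suitable \<open>F\<close>. Above any ordinal,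
  a closure point is the supremum of \<open>\<omega>\<close> steps, each of which passes all values of \<open>F\<close> up to the
  previous one; it lies below \<open>\<lambda>\<close> because \<open>\<lambda>\<close> is regular.
\<close>

lemma club_closure_points:
  assumes F: "\<And>a. a \<in> Field lam \<Longrightarrow> F a \<in> Field lam"
  shows "club lam {d. limit d \<and> (\<forall>a. a \<sqsubset> d \<longrightarrow> F a \<sqsubset> d)}" (is "club lam ?C")
proof -
  have unb: "\<exists>b\<in>?C. a \<sqsubseteq> b" if a: "a \<in> Field lam" for a
  proof -
    have "\<exists>y. y \<in> Field lam \<and> (\<forall>c. c \<sqsubseteq> x \<longrightarrow> c \<sqsubset> y \<and> F c \<sqsubset> y)" if x: "x \<in> Field lam" for x
    proof -
      obtain z where z: "x \<sqsubset> z" using ex_greater[OF x] by blast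
      have "F c \<in> Field lam" if "c \<sqsubset> z" for c using F[OF less_Field1[OF that]] .
      then obtain b where b: "b \<in> Field lam" "\<forall>c\<in>underS lam z. F c \<sqsubset> b"
        using bounded_image[OF segment_small[OF less_Field2[OF z]], of F] by meson
      have "|{b, z}| \<le>o par" by (rule ordLess_imp_ordLeq[OF small_finite]) simp
      then obtain y where "b \<sqsubset> y" "z \<sqsubset> y"
        using bounded_lam[of "{b, z}"] b(1) less_Field2[OF z] by auto
      moreover have "c \<sqsubset> z" if "c \<sqsubseteq> x" for c using that z leq_less_trans by blast
      ultimately show ?thesis using b(2) less_trans less_Field2 by blast
    qed
    then obtain g where g: "\<And>x. x \<in> Field lam \<Longrightarrow> g x \<in> Field lam"
        "\<And>x c. c \<sqsubseteq> x \<Longrightarrow> c \<sqsubset> g x \<and> F c \<sqsubset> g x"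
      using leq_Field by metis
    define s where "s n = (g ^^ n) a" for n
    have s: "s n \<in> Field lam" for n by (induction n) (auto simp: s_def a g)
    have ss: "c \<sqsubseteq> s n \<Longrightarrow> c \<sqsubset> s (Suc n) \<and> F c \<sqsubset> s (Suc n)" for n c
      using g(2) by (auto simp: s_def)
    define U where "U = {u. \<forall>n. s n \<sqsubset> u}"
    have "|range s| \<le>o par"
      by (rule image_le_par[OF ordLess_imp_ordLeq[OF small_countable]])
    then have "U \<noteq> {}" using bounded_lam[of "range s"] s by (auto simp: U_def)
    moreover have "U \<subseteq> Field lam" using less_Field by (auto simp: U_def)
    ultimately obtain d where d: "d \<in> U" "\<And>u. u \<in> U \<Longrightarrow> d \<sqsubseteq> u"
      using ex_least[of U] by blast
    have sd: "s n \<sqsubset> d" for n using d by (auto simp: U_def)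
    have below: "\<exists>n. c \<sqsubseteq> s n" if "c \<sqsubset> d" for c
    proof (rule ccontr)
      assume "\<not> ?thesis"
      then have "c \<in> U" using not_less[OF that[THEN less_Field1] s]
        not_less[OF s that[THEN less_Field1]] by (auto simp: U_def)
      then show False using less_leq_trans[OF that d(2)] less_irrefl by blast
    qed
    have "(\<exists>b. c \<sqsubset> b \<and> b \<sqsubset> d) \<and> F c \<sqsubset> d" if c: "c \<sqsubset> d" for c
    proof -
      obtain n where "c \<sqsubseteq> s n" using below[OF c] by blast
      from ss[OF this] show ?thesis using sd[of "Suc n"] less_trans[OF _ sd] by blast
    qed
    moreover have "d \<in> Field lam" "underS lam d \<noteq> {}" using sd[of 0] less_Field2 by auto
    ultimately have "d \<in> ?C" by (simp add: limit_def)
    moreover have "a \<sqsubseteq> d" using sd[of 0] less_leq by (simp add: s_def)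
    ultimately show ?thesis by blast
  qed
  have closed: "limit d \<and> (\<forall>a. a \<sqsubset> d \<longrightarrow> F a \<sqsubset> d)"
    if "limit d" and C: "\<And>a. a \<sqsubset> d \<Longrightarrow> \<exists>b\<in>?C. b \<sqsubset> d \<and> a \<sqsubseteq> b" for d
  proof (intro conjI allI impI)
    fix a assume "a \<sqsubset> d"
    then obtain a' where "a \<sqsubset> a'" "a' \<sqsubset> d" using \<open>limit d\<close> by (auto simp: limit_def)
    then obtain b where "b \<in> ?C" "b \<sqsubset> d" "a' \<sqsubseteq> b" using C by blast
    then show "F a \<sqsubset> d" using less_leq_trans[OF \<open>a \<sqsubset> a'\<close>] less_trans[of "F a" b d] by simp
  qed (fact \<open>limit d\<close>)
  have "d \<in> ?C"
    if "d \<in> Field lam" "limit_ordinal (seg lam d)" "unbounded (seg lam d) (?C \<inter> underS lam d)" for d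
    using that(2,3) closed[of d] unfolding limit_ordinal_seg[OF that(1)] unbounded_seg by blast
  moreover have "?C \<subseteq> Field lam" by (auto simp: limit_def)
  ultimately show ?thesis
    unfolding club_def unbounded_def using unb by blast
qed

lemma stationary_meets_closure_points:
  assumes "stationary lam X" and "\<And>a. a \<in> Field lam \<Longrightarrow> F a \<in> Field lam"
  shows "\<exists>d\<in>X. limit d \<and> (\<forall>a. a \<sqsubset> d \<longrightarrow> F a \<sqsubset> d)"
  using club_closure_points[OF assms(2)] assms(1) unfolding stationary_def by fastforce

lemma limit_points_of_unbounded:
  assumes "stationary lam X" "U \<subseteq> Field lam" "\<And>a. a \<in> Field lam \<Longrightarrow> \<exists>u\<in>U. a \<sqsubset> u"
  shows "\<exists>d\<in>X. limit d \<and> (\<forall>a. a \<sqsubset> d \<longrightarrow> (\<exists>u\<in>U. a \<sqsubset> u \<and> u \<sqsubset> d))"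
proof -
  obtain F where F: "\<And>a. a \<in> Field lam \<Longrightarrow> F a \<in> U \<and> a \<sqsubset> F a" using assms(3) by metis
  have "F a \<in> Field lam" if "a \<in> Field lam" for a using F[OF that] assms(2) by blast
  then obtain d where d: "d \<in> X" "limit d" "\<forall>a. a \<sqsubset> d \<longrightarrow> F a \<sqsubset> d"
    using stationary_meets_closure_points[OF assms(1), of F] by blast
  have "\<exists>u\<in>U. a \<sqsubset> u \<and> u \<sqsubset> d" if "a \<sqsubset> d" for a
    using F[OF less_Field1[OF that]] d(3) that by blast
  then show ?thesis using d by blast
qed

text \<open>
  If each colour class were bounded, the at most \<open>\<partial>\<close> many bounds would be bounded together.
\<close>

lemma pigeonhole_unbounded:
  assumes "\<And>a. a \<in> Field lam \<Longrightarrow> \<exists>u\<in>U. a \<sqsubset> u" and "k ` U \<subseteq> K" and "|K| \<le>o par"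
  shows "\<exists>i\<in>K. \<forall>a\<in>Field lam. \<exists>u\<in>U. k u = i \<and> a \<sqsubset> u"
proof (rule ccontr)
  assume "\<not> ?thesis"
  then obtain e where e: "\<And>i. i \<in> K \<Longrightarrow> e i \<in> Field lam \<and> (\<forall>u\<in>U. k u = i \<longrightarrow> \<not> e i \<sqsubset> u)" by metis
  have "e i \<in> Field lam" if "i \<in> K" for i using e[OF that] by simp
  then obtain b where b: "b \<in> Field lam" "\<forall>i\<in>K. e i \<sqsubset> b"
    using bounded_image[OF assms(3), of e] by meson
  obtain u where "u \<in> U" "b \<sqsubset> u" using assms(1) b by blast
  moreover have "k u \<in> K" using \<open>u \<in> U\<close> assms(2) by blast
  ultimately show False using b(2) e[of "k u"] less_trans[of "e (k u)" b u] by blast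
qed


lemma clubD:
  assumes "club lam C"
  shows "C \<subseteq> Field lam" and "a \<in> Field lam \<Longrightarrow> \<exists>c\<in>C. a \<sqsubset> c"
    and "limit d \<Longrightarrow> (\<And>a. a \<sqsubset> d \<Longrightarrow> \<exists>c\<in>C. a \<sqsubseteq> c \<and> c \<sqsubset> d) \<Longrightarrow> d \<in> C"
proof -
  show "C \<subseteq> Field lam" using assms by (simp add: club_def unbounded_def)
  show "\<exists>c\<in>C. a \<sqsubset> c" if a: "a \<in> Field lam"
  proof -
    obtain b where b: "a \<sqsubset> b" using ex_greater[OF a] by blast
    then obtain c where "c \<in> C" "b \<sqsubseteq> c"
      using assms less_Field2[OF b] unfolding club_def unbounded_def by blast
    then show ?thesis using less_leq_trans[OF b] by blast
  qed
  show "d \<in> C" if d: "limit d" and C: "\<And>a. a \<sqsubset> d \<Longrightarrow> \<exists>c\<in>C. a \<sqsubseteq> c \<and> c \<sqsubset> d"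
  proof -
    have F: "d \<in> Field lam" using d by (simp add: limit_def)
    have "\<exists>b\<in>C \<inter> underS lam d. a \<sqsubseteq> b" if "a \<sqsubset> d" for a
      using C[OF that] by blast
    then have "unbounded (seg lam d) (C \<inter> underS lam d)" unfolding unbounded_seg by simp
    then show ?thesis using assms F d limit_ordinal_seg[OF F] unfolding club_def by blast
  qed
qed

lemma le_par_iff: "|A| \<le>o par \<longleftrightarrow> |A| \<le>o |Field par|"
  using card_of_Field_ordIso[OF Card_par] ordIso_symmetric ordLeq_ordIso_trans by metis

text \<open>
  In a club \<open>C\<close>, the least \<open>d\<close> with \<open>|C \<inter> d| \<ge> \<partial>\<close> has cofinality \<open>\<partial>\<close>: a cofinal set of fewer than
  \<open>\<partial>\<close> ordinals would write \<open>C \<inter> d\<close> as a union of fewer than \<open>\<partial>\<close> sets of size \<open>< \<partial>\<close>. This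
  avoids a transfinite recursion of length \<open>\<partial>\<close>.
\<close>

lemma stationary_cof_par: "stationary lam {d. cof_par d}"
  unfolding stationary_def
proof (intro conjI allI impI)
  show "{d. cof_par d} \<subseteq> Field lam" by (auto simp: cof_par_def limit_def)
  fix C assume club: "club lam C"
  note C = clubD[OF club]
  have "cofinal C lam" using C(2) unfolding cofinal_def by (fastforce simp: underS_def)
  then have "|C| =o lam" using lam_reg C(1) by (simp add: regularCard_def)
  then have "par \<le>o |C|"
    using par_less_lam ordIso_symmetric ordLess_ordIso_trans ordLess_imp_ordLeq by metis
  then have "|Field par| \<le>o |C|"
    using card_of_Field_ordIso[OF Card_par] ordIso_ordLeq_trans by metis
  then obtain f where f: "inj_on f (Field par)" "f ` Field par \<subseteq> C"
    unfolding card_of_ordLeq[symmetric] by blast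
  have "|f ` Field par| \<le>o par" using image_le_par le_par_iff card_of_mono1 by blast
  then obtain b where b: "b \<in> Field lam" "\<forall>a\<in>f ` Field par. a \<sqsubset> b"
    using bounded_lam[of "f ` Field par"] f(2) C(1) by auto
  define B where "B = {d \<in> Field lam. \<not> |C \<inter> underS lam d| <o par}"
  have "|Field par| \<le>o |C \<inter> underS lam b|"
    unfolding card_of_ordLeq[symmetric] using f b(2) by blast
  then have "par \<le>o |C \<inter> underS lam b|"
    using card_of_Field_ordIso[OF Card_par] ordIso_symmetric ordIso_ordLeq_trans by metis
  then have "b \<in> B" using b(1) not_ordLess_ordLeq by (auto simp: B_def)
  then obtain d where d: "d \<in> B" "\<forall>a\<in>B. d \<sqsubseteq> a" using ex_least[of B] by (auto simp: B_def)
  have big: "\<not> |C \<inter> underS lam d| <o par" using d by (simp add: B_def)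
  have small: "|C \<inter> underS lam a| <o par" if a: "a \<sqsubset> d" for a
  proof (rule ccontr)
    assume "\<not> ?thesis"
    then have "a \<in> B" using less_Field1[OF a] by (simp add: B_def)
    then show False using d(2) less_leq_trans[OF a, of a] less_irrefl by blast
  qed
  have next_C: "\<exists>c\<in>C. e \<sqsubset> c \<and> c \<sqsubset> d" if e: "e \<sqsubset> d" for e
  proof (rule ccontr)
    assume neg: "\<not> ?thesis"
    have "C \<inter> underS lam d \<subseteq> (\<Union>X\<in>{C \<inter> underS lam e, {e}}. X)"
    proof
      fix c assume c: "c \<in> C \<inter> underS lam d"
      then have "c \<sqsubseteq> e" using neg not_less[of e c] less_Field1[OF e] C(1) by blast
      then show "c \<in> (\<Union>X\<in>{C \<inter> underS lam e, {e}}. X)"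
        using c leq_iff[of c e] C(1) by blast
    qed
    moreover have "|\<Union>X\<in>{C \<inter> underS lam e, {e}}. X| <o par"
    proof (rule small_UNION)
      show "|{C \<inter> underS lam e, {e}}| <o par" by (rule small_finite) simp
      show "|X| <o par" if "X \<in> {C \<inter> underS lam e, {e}}" for X
        using that small[OF e] small_finite[of "{e}"] by auto
    qed
    ultimately show False using big card_of_mono1 ordLeq_ordLess_trans by blast
  qed
  have "limit d"
  proof -
    have "underS lam d \<noteq> {}"
    proof
      assume "underS lam d = {}"
      then have "|C \<inter> underS lam d| <o par" using small_finite[of "{}"] by simp
      then show False using big by blast
    qed
    then show ?thesis using next_C d(1) unfolding limit_def B_def by blast
  qed
  moreover have "\<exists>e. e \<sqsubset> d \<and> (\<forall>a\<in>A. a \<sqsubseteq> e)" if A: "A \<subseteq> underS lam d" "|A| <o par" for A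
  proof (rule ccontr)
    assume neg: "\<not> ?thesis"
    have "C \<inter> underS lam d \<subseteq> (\<Union>a\<in>A. C \<inter> underS lam a)"
    proof
      fix c assume c: "c \<in> C \<inter> underS lam d"
      then obtain a where a: "a \<in> A" "\<not> a \<sqsubseteq> c" using neg by blast
      then have "c \<sqsubset> a" using not_less[of c a] c A(1) less_Field1 by blast
      then show "c \<in> (\<Union>a\<in>A. C \<inter> underS lam a)" using a(1) c by blast
    qed
    moreover have "|\<Union>a\<in>A. C \<inter> underS lam a| <o par"
      by (rule small_UNION[OF A(2)]) (use small A(1) in blast)
    ultimately show False using big card_of_mono1 ordLeq_ordLess_trans by blast
  qed
  ultimately have "cof_par d" by (simp add: cof_par_def)
  moreover have "d \<in> C" using C(3)[OF \<open>limit d\<close>] next_C less_leq by blast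
  ultimately show "{d. cof_par d} \<inter> C \<noteq> {}" by blast
qed

text \<open>
  Fix injections \<open>h d\<close> from \<open>d\<close> into \<open>\<partial>\<close> and let \<open>A i a\<close> consist of the \<open>d \<in> X\<close> with \<open>h d a = i\<close>. Injectivity
  makes each row disjoint, and each column covers \<open>X\<close> up to a bounded set. If all sets in the column
  of \<open>a\<close> missed clubs, an ordinal in \<open>X\<close> beyond \<open>a\<close> in the intersection of these \<open>\<partial>\<close> many clubs
  would be in none of them.
\<close>

lemma ulam_matrix:
  assumes "stationary lam X"
  shows "\<exists>A :: 'b \<Rightarrow> 'a \<Rightarrow> 'a set. (\<forall>i a. A i a \<subseteq> X) \<and> (\<forall>i a b. a \<noteq> b \<longrightarrow> A i a \<inter> A i b = {}) \<and>
    (\<forall>a\<in>Field lam. \<exists>i\<in>Field par. stationary lam (A i a))"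
proof -
  have XF: "X \<subseteq> Field lam" using assms by (simp add: stationary_def)
  have "\<exists>g. inj_on g (underS lam d) \<and> g ` underS lam d \<subseteq> Field par" if "d \<in> Field lam" for d
    using segment_small[OF that] unfolding le_par_iff card_of_ordLeq .
  then obtain h where h: "\<And>d. d \<in> Field lam \<Longrightarrow> inj_on (h d) (underS lam d)"
    "\<And>d. d \<in> Field lam \<Longrightarrow> h d ` underS lam d \<subseteq> Field par" by metis
  define A where "A i a = {d \<in> X. a \<sqsubset> d \<and> h d a = i}" for i a
  have "\<exists>i\<in>Field par. stationary lam (A i a)" if a: "a \<in> Field lam" for a
  proof (rule ccontr)
    assume "\<not> ?thesis"
    then have "\<forall>i\<in>Field par. \<exists>C. club lam C \<and> A i a \<inter> C = {}"
      unfolding stationary_def using XF by (auto simp: A_def)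
    then obtain C where C: "\<And>i. i \<in> Field par \<Longrightarrow> club lam (C i)"
      "\<And>i. i \<in> Field par \<Longrightarrow> A i a \<inter> C i = {}" by metis
    have "\<forall>x\<in>Field lam. \<forall>i\<in>Field par. \<exists>c\<in>C i. x \<sqsubset> c" using clubD(2)[OF C(1)] by blast
    then obtain g where g: "\<And>x i. x \<in> Field lam \<Longrightarrow> i \<in> Field par \<Longrightarrow> g x i \<in> C i \<and> x \<sqsubset> g x i" by metis
    have "\<exists>y\<in>Field lam. a \<sqsubset> y \<and> (\<forall>i\<in>Field par. g x i \<sqsubset> y)" if x: "x \<in> Field lam" for x
    proof -
      have "|Field par| \<le>o par" using le_par_iff card_of_mono1 by blast
      moreover have "g x i \<in> Field lam" if "i \<in> Field par" for i using g[OF x that] less_Field2 by blast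
      ultimately obtain z where z: "z \<in> Field lam" "\<forall>i\<in>Field par. g x i \<sqsubset> z"
        using bounded_image[of "Field par" "g x"] by blast
      have "|{a, z}| \<le>o par" by (rule ordLess_imp_ordLeq[OF small_finite]) simp
      then obtain y where "y \<in> Field lam" "a \<sqsubset> y" "z \<sqsubset> y"
        using bounded_lam[of "{a, z}"] a z(1) by auto
      then show ?thesis using z(2) less_trans[of _ z y] by blast
    qed
    \<comment> \<open>Closure points of \<open>F\<close> lie above \<open>a\<close> and are limits of every \<open>C i\<close>, hence in every \<open>C i\<close>.\<close>
    then obtain F where F: "\<And>x. x \<in> Field lam \<Longrightarrow> F x \<in> Field lam"
      "\<And>x. x \<in> Field lam \<Longrightarrow> a \<sqsubset> F x"
      "\<And>x i. x \<in> Field lam \<Longrightarrow> i \<in> Field par \<Longrightarrow> g x i \<sqsubset> F x" by metis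
    obtain d where d: "d \<in> X" "limit d" "\<forall>x. x \<sqsubset> d \<longrightarrow> F x \<sqsubset> d"
      using stationary_meets_closure_points[OF assms, of F] F(1) by blast
    obtain x where x: "x \<sqsubset> d" using d(2) by (auto simp: limit_def)
    have ad: "a \<sqsubset> d" using less_trans[OF F(2)[OF less_Field1[OF x]]] d(3) x by blast
    define i where "i = h d a"
    have i: "i \<in> Field par" using h(2)[of d] ad less_Field2[OF ad] by (auto simp: i_def)
    have "\<exists>c\<in>C i. u \<sqsubseteq> c \<and> c \<sqsubset> d" if u: "u \<sqsubset> d" for u
      using g[OF less_Field1[OF u] i] less_trans[OF F(3)[OF less_Field1[OF u] i]] d(3) u less_leq
      by blast
    then have "d \<in> C i" by (rule clubD(3)[OF C(1)[OF i] d(2)])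
    moreover have "d \<in> A i a" using d(1) ad by (simp add: A_def i_def)
    ultimately show False using C(2)[OF i] by blast
  qed
  moreover have "A i a \<inter> A i b = {}" if "a \<noteq> b" for i a b
    using h(1) that XF by (auto simp: A_def inj_on_def)
  moreover have "A i a \<subseteq> X" for i a by (auto simp: A_def)
  ultimately show ?thesis by (intro exI[of _ A]) blast
qed

section \<open>Ladders that avoid a non-reflecting set\<close>

text \<open>
  Keep the values of \<open>s\<close> that exceed all earlier values: they form a cofinal set of order type at
  most \<open>\<omega>\<close>.
\<close>

lemma thin_ladder:
  fixes s :: "nat \<Rightarrow> 'a"
  assumes "range s \<subseteq> underS lam b" "\<And>a. a \<sqsubset> b \<Longrightarrow> \<exists>n. a \<sqsubseteq> s n"
  shows "\<exists>C. C \<subseteq> underS lam b \<and> (\<forall>a. a \<sqsubset> b \<longrightarrow> (\<exists>c\<in>C. a \<sqsubseteq> c)) \<and>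
    (\<forall>x. x \<sqsubset> b \<longrightarrow> finite {c \<in> C. c \<sqsubset> x})"
proof -
  define C where "C = {s n |n. \<forall>m<n. s m \<sqsubset> s n}"
  have sF: "s n \<in> Field lam" for n using assms(1) less_Field1 by blast
  have "\<exists>c\<in>C. a \<sqsubseteq> c" if a: "a \<sqsubset> b" for a
  proof -
    define n where "n = (LEAST n. a \<sqsubseteq> s n)"
    have n: "a \<sqsubseteq> s n" unfolding n_def using assms(2)[OF a] by (rule LeastI_ex)
    have "s m \<sqsubset> a" if "m < n" for m
      using not_less_Least[OF that[unfolded n_def]] not_less[OF sF less_Field1[OF a]] by blast
    then have "s n \<in> C" using less_leq_trans[OF _ n] by (auto simp: C_def)
    then show ?thesis using n by blast
  qed
  moreover have "finite {c \<in> C. c \<sqsubset> x}" if x: "x \<sqsubset> b" for x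
  proof -
    obtain n where n: "x \<sqsubseteq> s n" using assms(2)[OF x] by blast
    have "{c \<in> C. c \<sqsubset> x} \<subseteq> s ` {..n}"
    proof
      fix c assume "c \<in> {c \<in> C. c \<sqsubset> x}"
      then obtain k where k: "c = s k" "\<forall>m<k. s m \<sqsubset> s k" "s k \<sqsubset> x" by (auto simp: C_def)
      have "\<not> n < k"
        using k(2) less_trans[OF less_leq_trans[OF k(3) n], of "s k"] less_irrefl by blast
      then show "c \<in> s ` {..n}" using k(1) by simp
    qed
    then show ?thesis using finite_subset by blast
  qed
  ultimately show ?thesis using assms(1) by (intro exI[of _ C]) (auto simp: C_def)
qed

text \<open>
  If \<open>b\<close> is not a limit, its predecessor is enough. If \<open>cf b = \<omega>\<close>, take a cofinal set of type \<open>\<omega>\<close>; it has no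
  accumulation points below \<open>b\<close>. If \<open>cf b > \<omega>\<close>, then \<open>W \<inter> b\<close> is not stationary in \<open>b\<close>, and a club of
  \<open>b\<close> disjoint from \<open>W\<close> contains its own accumulation points.
\<close>

lemma avoiding_ladder:
  assumes "\<forall>d\<in>Field lam. \<not> reflects_in lam W d" and b: "b \<in> Field lam" and "underS lam b \<noteq> {}"
  shows "\<exists>C. C \<noteq> {} \<and> C \<subseteq> underS lam b \<and> (\<forall>a. a \<sqsubset> b \<longrightarrow> (\<exists>c\<in>C. a \<sqsubseteq> c)) \<and>
    (\<forall>x\<in>W. limit x \<longrightarrow> x \<sqsubset> b \<longrightarrow> (\<exists>e. e \<sqsubset> x \<and> (\<forall>c\<in>C. c \<sqsubset> x \<longrightarrow> c \<sqsubseteq> e)))"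
proof -
  have ne: "C \<noteq> {}" if "\<forall>a. a \<sqsubset> b \<longrightarrow> (\<exists>c\<in>C. a \<sqsubseteq> c)" for C using that assms(3) by blast
  consider (suc) "\<not> limit b" | (cof) "limit b" "\<not> natLeq <o cofinality (seg lam b)"
    | (unc) "limit b" "\<not> stationary (seg lam b) (W \<inter> underS lam b)"
    using assms(1) b limit_ordinal_seg[OF b] unfolding reflects_in_def by blast
  then show ?thesis
  proof cases
    case suc
    then obtain m where m: "m \<sqsubset> b" "\<forall>c. c \<sqsubset> b \<longrightarrow> \<not> m \<sqsubset> c"
      using b assms(3) unfolding limit_def by blast
    have "c \<sqsubseteq> m" if "c \<sqsubset> b" for c
      using m(2) that not_less[OF less_Field1[OF m(1)] less_Field1[OF that]] by blast
    moreover have "\<exists>e. e \<sqsubset> x \<and> (\<forall>c\<in>{m}. c \<sqsubset> x \<longrightarrow> c \<sqsubseteq> e)" if "limit x" "x \<sqsubset> b" for x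
      using m(2) that unfolding limit_def by blast
    ultimately show ?thesis using m(1) by (intro exI[of _ "{m}"]) blast
  next
    case cof
    have "Well_order (seg lam b)" unfolding seg_def by (rule Well_order_Restr[OF wo])
    then obtain A where A: "unbounded (seg lam b) A" "cofinality (seg lam b) = |A|"
      using cofinality_attained by blast
    have "\<not> natLeq <o |A|" using cof(2) A(2) by simp
    then have "|A| \<le>o natLeq"
      by (rule not_ordLess_iff_ordLeq[OF card_of_Well_order natLeq_Well_order, THEN iffD1])
    then have nat: "|A| \<le>o |UNIV :: nat set|"
      by (rule ordLeq_ordIso_trans[OF _ ordIso_symmetric[OF card_of_nat]])
    have A': "A \<subseteq> underS lam b" "\<forall>a. a \<sqsubset> b \<longrightarrow> (\<exists>c\<in>A. a \<sqsubseteq> c)"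
      using A(1) unfolding unbounded_seg by blast+
    have "A \<noteq> {}" using ne A'(2) by blast
    from card_of_ordLeq2[OF this, THEN iffD2, OF nat] obtain s :: "nat \<Rightarrow> 'a" where s: "range s = A" by blast
    obtain C where C: "C \<subseteq> underS lam b" "\<forall>a. a \<sqsubset> b \<longrightarrow> (\<exists>c\<in>C. a \<sqsubseteq> c)"
      "\<forall>x. x \<sqsubset> b \<longrightarrow> finite {c \<in> C. c \<sqsubset> x}"
      using thin_ladder[of s b] A' s by blast
    have "\<exists>e. e \<sqsubset> x \<and> (\<forall>c\<in>C. c \<sqsubset> x \<longrightarrow> c \<sqsubseteq> e)" if "limit x" "x \<sqsubset> b" for x
      using limit_bounds_finite[OF that(1), of "{c \<in> C. c \<sqsubset> x}"] C(3) that(2) by auto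
    then show ?thesis using C(1,2) ne[OF C(2)] by blast
  next
    case unc
    then obtain C where C: "club (seg lam b) C" "W \<inter> underS lam b \<inter> C = {}"
      unfolding stationary_def Field_seg by blast
    have C': "C \<subseteq> underS lam b" "\<forall>a. a \<sqsubset> b \<longrightarrow> (\<exists>c\<in>C. a \<sqsubseteq> c)"
      using C(1) unfolding club_def unbounded_seg by blast+
    have "\<exists>e. e \<sqsubset> x \<and> (\<forall>c\<in>C. c \<sqsubset> x \<longrightarrow> c \<sqsubseteq> e)" if x: "x \<in> W" "limit x" "x \<sqsubset> b" for x
    proof (rule ccontr)
      assume neg: "\<not> ?thesis"
      have "\<exists>c\<in>C \<inter> underS lam x. a \<sqsubseteq> c" if a: "a \<sqsubset> x" for a
      proof -
        obtain c where c: "c \<in> C" "c \<sqsubset> x" "\<not> c \<sqsubseteq> a" using neg a by blast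
        then have "a \<sqsubset> c" using not_less[OF less_Field1[OF a] less_Field1[OF c(2)]] by blast
        then show ?thesis using c less_leq by blast
      qed
      then have "unbounded (seg (seg lam b) x) (C \<inter> underS (seg lam b) x)"
        unfolding seg_seg[OF x(3)] underS_seg[OF x(3)] unbounded_seg by blast
      moreover have "limit_ordinal (seg (seg lam b) x)"
        using x(2) limit_ordinal_seg[OF less_Field1[OF x(3)]] unfolding seg_seg[OF x(3)] by blast
      moreover have "x \<in> Field (seg lam b)" using x(3) by (simp add: Field_seg)
      ultimately have "x \<in> C" using C(1) unfolding club_def by blast
      then show False using C(2) x(1,3) by blast
    qed
    then show ?thesis using C' ne[OF C'(2)] by blast
  qed
qed

lemma ladder_function:
  assumes "\<forall>d\<in>Field lam. \<not> reflects_in lam W d"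
  shows "\<exists>f. (\<forall>b i a. i \<in> Field par \<longrightarrow> a \<sqsubset> b \<longrightarrow> f b i \<sqsubset> b) \<and>
    (\<forall>a b. a \<sqsubset> b \<longrightarrow> (\<exists>i\<in>Field par. a \<sqsubseteq> f b i)) \<and>
    (\<forall>x\<in>W. \<forall>b. limit x \<longrightarrow> x \<sqsubset> b \<longrightarrow>
      (\<exists>e. e \<sqsubset> x \<and> (\<forall>i\<in>Field par. f b i \<sqsubset> x \<longrightarrow> f b i \<sqsubseteq> e)))"
proof -
  have ex: "\<exists>g. \<forall>a. a \<sqsubset> b \<longrightarrow> g ` Field par \<subseteq> underS lam b \<and> (\<exists>i\<in>Field par. a \<sqsubseteq> g i) \<and>
    (\<forall>x\<in>W. limit x \<longrightarrow> x \<sqsubset> b \<longrightarrow> (\<exists>e. e \<sqsubset> x \<and> (\<forall>i\<in>Field par. g i \<sqsubset> x \<longrightarrow> g i \<sqsubseteq> e)))" for b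
  proof (cases "underS lam b = {}")
    case True
    then show ?thesis by blast
  next
    case False
    then have b: "b \<in> Field lam" using less_Field2 by blast
    obtain C where C: "C \<noteq> {}" "C \<subseteq> underS lam b" "\<forall>a. a \<sqsubset> b \<longrightarrow> (\<exists>c\<in>C. a \<sqsubseteq> c)"
      "\<forall>x\<in>W. limit x \<longrightarrow> x \<sqsubset> b \<longrightarrow> (\<exists>e. e \<sqsubset> x \<and> (\<forall>c\<in>C. c \<sqsubset> x \<longrightarrow> c \<sqsubseteq> e))"
      using avoiding_ladder[OF assms b False] by blast
    have "|C| \<le>o |Field par|"
      using ordLeq_transitive[OF card_of_mono1[OF C(2)] segment_small[OF b]] unfolding le_par_iff .
    from card_of_ordLeq2[OF C(1), THEN iffD2, OF this] obtain g where g: "g ` Field par = C" by blast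
    have "\<exists>i\<in>Field par. a \<sqsubseteq> g i" if "a \<sqsubset> b" for a using C(3) that g by blast
    moreover have "\<exists>e. e \<sqsubset> x \<and> (\<forall>i\<in>Field par. g i \<sqsubset> x \<longrightarrow> g i \<sqsubseteq> e)"
      if "x \<in> W" "limit x" "x \<sqsubset> b" for x
      using C(4) that g by blast
    ultimately show ?thesis using C(2) g by (intro exI[of _ g]) simp
  qed
  have "\<exists>f. \<forall>b a. a \<sqsubset> b \<longrightarrow> f b ` Field par \<subseteq> underS lam b \<and> (\<exists>i\<in>Field par. a \<sqsubseteq> f b i) \<and>
    (\<forall>x\<in>W. limit x \<longrightarrow> x \<sqsubset> b \<longrightarrow> (\<exists>e. e \<sqsubset> x \<and> (\<forall>i\<in>Field par. f b i \<sqsubset> x \<longrightarrow> f b i \<sqsubseteq> e)))"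
    by (rule choice, rule allI, rule ex)
  then obtain f where f: "\<forall>b a. a \<sqsubset> b \<longrightarrow> f b ` Field par \<subseteq> underS lam b \<and>
    (\<exists>i\<in>Field par. a \<sqsubseteq> f b i) \<and>
    (\<forall>x\<in>W. limit x \<longrightarrow> x \<sqsubset> b \<longrightarrow> (\<exists>e. e \<sqsubset> x \<and> (\<forall>i\<in>Field par. f b i \<sqsubset> x \<longrightarrow> f b i \<sqsubseteq> e)))" ..
  have "f b i \<sqsubset> b" if "i \<in> Field par" "a \<sqsubset> b" for b i a using f that by blast
  moreover have "\<exists>i\<in>Field par. a \<sqsubseteq> f b i" if "a \<sqsubset> b" for a b using f that by blast
  moreover have "\<exists>e. e \<sqsubset> x \<and> (\<forall>i\<in>Field par. f b i \<sqsubset> x \<longrightarrow> f b i \<sqsubseteq> e)"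
    if "x \<in> W" "limit x" "x \<sqsubset> b" for x b
    using f[rule_format, OF that(3)] that by blast
  ultimately show ?thesis by (intro exI[of _ f]) simp
qed

lemma stationary_limits:
  assumes "stationary lam W" shows "stationary lam {x \<in> W. limit x}"
  unfolding stationary_def
proof (intro conjI allI impI)
  show "{x \<in> W. limit x} \<subseteq> Field lam" by (auto simp: limit_def)
  fix C assume C: "club lam C"
  obtain d where d: "d \<in> W" "limit d" "\<forall>a. a \<sqsubset> d \<longrightarrow> (\<exists>u\<in>C. a \<sqsubset> u \<and> u \<sqsubset> d)"
    using limit_points_of_unbounded[OF assms clubD(1)[OF C]] clubD(2)[OF C] by blast
  have "d \<in> C" by (rule clubD(3)[OF C d(2)]) (use d(3) less_leq in blast)
  then show "{x \<in> W. limit x} \<inter> C \<noteq> {}" using d by blast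
qed

text \<open>
  An injective family has at most \<open>\<partial>\<close> many rows that meet the ordinals up to \<open>x\<close>, so some row beyond
  \<open>k\<close> lies above \<open>x\<close> entirely.
\<close>

lemma injective_family_escapes:
  assumes inj: "inj_on z (Field lam \<times> J)" and z: "z \<in> Field lam \<times> J \<rightarrow> Field lam"
    and x: "x \<in> Field lam" and k: "k \<in> Field lam"
  shows "\<exists>a. k \<sqsubset> a \<and> (\<forall>j\<in>J. x \<sqsubset> z (a, j))"
proof (rule ccontr)
  assume neg: "\<not> ?thesis"
  let ?A = "{a. k \<sqsubset> a}"
  obtain y where y: "x \<sqsubset> y" using ex_greater[OF x] by blast
  have "\<exists>j\<in>J. z (a, j) \<sqsubset> y" if a: "k \<sqsubset> a" for a
  proof -
    obtain j where j: "j \<in> J" "\<not> x \<sqsubset> z (a, j)" using neg a by blast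
    have "z (a, j) \<in> Field lam" using z j(1) less_Field2[OF a] by blast
    then have "z (a, j) \<sqsubseteq> x" using not_less[OF x] j(2) by blast
    then show ?thesis using leq_less_trans[OF _ y] j(1) by blast
  qed
  then obtain g where g: "\<And>a. k \<sqsubset> a \<Longrightarrow> g a \<in> J" "\<And>a. k \<sqsubset> a \<Longrightarrow> z (a, g a) \<sqsubset> y" by metis
  have "inj_on (\<lambda>a. z (a, g a)) ?A"
  proof (rule inj_onI)
    fix a b assume ab: "a \<in> ?A" "b \<in> ?A" "z (a, g a) = z (b, g b)"
    then have "(a, g a) \<in> Field lam \<times> J" "(b, g b) \<in> Field lam \<times> J"
      using g(1) less_Field2 by simp_all
    then show "a = b" using inj_onD[OF inj ab(3)] by simp
  qed
  moreover have "(\<lambda>a. z (a, g a)) ` ?A \<subseteq> underS lam y" using g(2) by blast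
  ultimately have "|?A| \<le>o |underS lam y|" unfolding card_of_ordLeq[symmetric] by blast
  then have "|?A| \<le>o par" by (rule ordLeq_transitive[OF _ segment_small[OF less_Field2[OF y]]])
  moreover have "?A \<subseteq> Field lam" using less_Field2 by blast
  ultimately obtain b where b: "\<forall>a\<in>?A. a \<sqsubset> b" using bounded_lam by blast
  obtain a where a: "k \<sqsubset> a" using ex_greater[OF k] by blast
  have "k \<sqsubset> b" using less_trans[OF a] b a by blast
  then show False using b less_irrefl by blast
qed

section \<open>The position of the first maximum in a list of weights\<close>

definition peak where
  "peak ws = (LEAST k. k < length ws \<and> (\<forall>j<length ws. (ws ! j, ws ! k) \<in> par))"

lemma peak:
  assumes "ws \<noteq> []" "set ws \<subseteq> Field par"
  shows "peak ws < length ws \<and> (\<forall>j<length ws. (ws ! j, ws ! peak ws) \<in> par)"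
proof -
  obtain m where "m \<in> set ws" "\<forall>a\<in>set ws. (a, m) \<in> par" using ex_max_par[of "set ws"] assms by auto
  then obtain k where "k < length ws \<and> (\<forall>j<length ws. (ws ! j, ws ! k) \<in> par)"
    by (metis in_set_conv_nth nth_mem)
  then show ?thesis unfolding peak_def by (rule LeastI)
qed

text \<open>
  Low entries before and after \<open>M\<close> do not disturb its first maximum. Entries of \<open>T\<close> have to be strictly
  below \<open>m\<close>, since a tie in front of \<open>M\<close> would move the first maximum.
\<close>

lemma peak_append:
  assumes M: "set M \<subseteq> Field par" "m \<in> set M"
    and low: "\<And>t. t \<in> set T \<union> set K \<Longrightarrow> t \<in> underS par m"
  shows "peak (T @ M @ K) = length T + peak M"
  unfolding peak_def[of "T @ M @ K"]
proof (rule Least_equality)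
  let ?s = "T @ M @ K" and ?k = "peak M"
  have k: "?k < length M" "\<forall>j<length M. (M ! j, M ! ?k) \<in> par" using peak[OF _ M(1)] M(2) by fastforce+
  obtain i where i: "i < length M" "M ! i = m" using M(2) by (auto simp: in_set_conv_nth)
  have "(c, M ! ?k) \<in> par" if "c \<in> set ?s" for c
  proof -
    have mk: "(m, M ! ?k) \<in> par" using k(2) i by blast
    consider "c \<in> set T \<union> set K" | "c \<in> set M" using \<open>c \<in> set ?s\<close> by auto
    then show ?thesis
    proof cases
      case 1
      then show ?thesis using par_less_trans[OF low mk] by (auto simp: underS_def)
    next
      case 2
      then show ?thesis using k(2) by (auto simp: in_set_conv_nth)
    qed
  qed
  then show "length T + ?k < length ?s \<and> (\<forall>j<length ?s. (?s ! j, ?s ! (length T + ?k)) \<in> par)"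
    using k(1) nth_mem[of _ ?s] by (simp add: nth_append)
  fix y assume y: "y < length ?s \<and> (\<forall>j<length ?s. (?s ! j, ?s ! y) \<in> par)"
  show "length T + ?k \<le> y"
  proof (rule ccontr)
    assume "\<not> ?thesis"
    then have ylt: "y < length T + ?k" by simp
    show False
    proof (cases "y < length T")
      case True
      have "(?s ! (length T + i), ?s ! y) \<in> par" using y[THEN conjunct2, rule_format, of "length T + i"] i(1) by simp
      then have "(m, T ! y) \<in> par" using True i by (simp add: nth_append)
      then show False using low[of "T ! y"] True wo_rel.ANTISYM[OF wor_par]
        by (auto simp: underS_def antisym_def)
    next
      case False
      define z where "z = y - length T"
      have z: "y = length T + z" "z < ?k" using False ylt by (auto simp: z_def)
      have "(M ! j, M ! z) \<in> par" if "j < length M" for j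
      proof -
        have "(?s ! (length T + j), ?s ! y) \<in> par" using y[THEN conjunct2, rule_format, of "length T + j"] that by simp
        then show ?thesis using that z k(1) by (simp add: nth_append)
      qed
      then show False using not_less_Least[of z "\<lambda>k. k < length M \<and> (\<forall>j<length M. (M ! j, M ! k) \<in> par)"]
          z(2) k(1) by (simp add: peak_def)
    qed
  qed
qed

end

section \<open>Walks along ladders\<close>

locale ladder_system = successor_of_regular lam par
  for lam :: "'a rel" and par :: "'b rel" +
  fixes W :: "'a set" and f :: "'a \<Rightarrow> 'b \<Rightarrow> 'a"
  assumes W_stationary: "stationary lam W"
    and W_limit: "x \<in> W \<Longrightarrow> limit x"
    and W_cof: "x \<in> W \<Longrightarrow> \<exists>D. D \<subseteq> underS lam x \<and> |D| <o par \<and> (\<forall>a. a \<sqsubset> x \<longrightarrow> (\<exists>d\<in>D. a \<sqsubseteq> d))"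
    and f_below: "i \<in> Field par \<Longrightarrow> a \<sqsubset> b \<Longrightarrow> f b i \<sqsubset> b"
    and f_cofinal: "a \<sqsubset> b \<Longrightarrow> \<exists>i\<in>Field par. a \<sqsubseteq> f b i"
    and f_avoids: "x \<in> W \<Longrightarrow> x \<sqsubset> b \<Longrightarrow> \<exists>e. e \<sqsubset> x \<and> (\<forall>i\<in>Field par. f b i \<sqsubset> x \<longrightarrow> f b i \<sqsubseteq> e)"
begin

definition weight where
  "weight b a = wo_rel.minim par {i \<in> Field par. a \<sqsubseteq> f b i}"

lemma weight:
  assumes "a \<sqsubset> b"
  shows weight_Field: "weight b a \<in> Field par" and leq_step: "a \<sqsubseteq> f b (weight b a)"
    and below_weight: "j \<in> underS par (weight b a) \<Longrightarrow> f b j \<sqsubset> a"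
proof -
  let ?I = "{i \<in> Field par. a \<sqsubseteq> f b i}"
  have sub: "?I \<subseteq> Field par" by blast
  have "?I \<noteq> {}" using f_cofinal[OF assms] by blast
  from wo_rel.minim_in[OF wor_par sub this]
  show 1: "weight b a \<in> Field par" "a \<sqsubseteq> f b (weight b a)" by (auto simp: weight_def)
  assume j: "j \<in> underS par (weight b a)"
  then have jF: "j \<in> Field par" by (auto simp: underS_def Field_def)
  show "f b j \<sqsubset> a"
  proof (rule ccontr)
    assume "\<not> ?thesis"
    then have "a \<sqsubseteq> f b j"
      using not_less[OF less_Field1[OF f_below[OF jF assms]] less_Field1[OF assms]] by blast
    then have "(weight b a, j) \<in> par"
      unfolding weight_def using wo_rel.minim_least[OF wor_par sub, of j] jF by blast
    then show False using j wo_rel.ANTISYM[OF wor_par] by (auto simp: underS_def antisym_def)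
  qed
qed

lemma weight_eqI:
  assumes "a \<sqsubset> b" "i \<in> Field par" "a \<sqsubseteq> f b i" "\<And>j. j \<in> underS par i \<Longrightarrow> f b j \<sqsubset> a"
  shows "weight b a = i"
proof (rule ccontr)
  assume "weight b a \<noteq> i"
  then consider "weight b a \<in> underS par i" | "i \<in> underS par (weight b a)"
    using wo_rel.TOTALS[OF wor_par] weight_Field[OF assms(1)] assms(2)
    by (auto simp: underS_def)
  then show False
  proof cases
    case 1
    then show False using assms(4) less_leq_trans[OF _ leq_step[OF assms(1)]] less_irrefl by blast
  next
    case 2
    then show False
      using less_leq_trans[OF below_weight[OF assms(1)] assms(3)] less_irrefl by blast
  qed
qed

definition step where "step b a = f b (weight b a)"

text \<open>
  The list contains the nodes from the start down to the last one above the target; leaving out the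
  target itself makes concatenation of walks plain list concatenation.
\<close>

inductive walk where
  walk_stop: "walk a a []"
| walk_step: "a \<sqsubset> b \<Longrightarrow> walk (step b a) a ns \<Longrightarrow> walk b a (b # ns)"

lemma walk_exists:
  assumes "b \<in> Field lam" "a \<sqsubseteq> b" shows "\<exists>ns. walk b a ns"
  using assms
proof (induction b rule: less_induct)
  case (less b)
  show ?case
  proof (cases "a \<sqsubset> b")
    case True
    have "\<exists>ns. walk (step b a) a ns"
      using less.IH[of "step b a"] f_below[OF weight_Field[OF True] True] leq_step[OF True]
      by (simp add: step_def)
    then show ?thesis using walk_step[OF True] by blast
  next
    case False
    then have "a = b" using less.prems by (auto simp: underS_def)
    then show ?thesis using walk_stop by blast
  qed
qed

lemma walk_unique: "walk b a ns \<Longrightarrow> walk b a ms \<Longrightarrow> ns = ms"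
proof (induction arbitrary: ms rule: walk.induct)
  case (walk_stop a)
  then show ?case using less_irrefl by (auto elim: walk.cases)
next
  case (walk_step a b ns)
  from walk_step.prems walk_step.hyps(1) less_irrefl
  obtain ns' where "ms = b # ns'" "walk (step b a) a ns'" by (auto elim: walk.cases)
  then show ?case using walk_step.IH by blast
qed

definition trace where "trace b a = (THE ns. walk b a ns)"

lemma trace_eqI: "walk b a ns \<Longrightarrow> trace b a = ns"
  unfolding trace_def using walk_unique by blast

lemma walk_trace: "a \<sqsubset> b \<Longrightarrow> walk b a (trace b a)"
  using walk_exists[OF less_Field2 less_leq] trace_eqI by metis

lemma walk_nodes: "walk b a ns \<Longrightarrow> v \<in> set ns \<Longrightarrow> a \<sqsubset> v"
  by (induction rule: walk.induct) auto

text \<open>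
  The nodes of a walk to \<open>d\<close> take the same steps towards any \<open>a < d\<close> towards which they have the same
  weights.
\<close>

lemma walk_append:
  "walk b d ns \<Longrightarrow> (\<And>v. v \<in> set ns \<Longrightarrow> weight v a = weight v d) \<Longrightarrow> a \<sqsubset> d \<Longrightarrow> walk d a ms
    \<Longrightarrow> walk b a (ns @ ms)"
proof (induction rule: walk.induct)
  case (walk_stop d)
  then show ?case by simp
next
  case (walk_step d b ns)
  have "step b a = step b d" using walk_step.prems(1)[of b] by (simp add: step_def)
  moreover have "a \<sqsubset> b" using less_trans walk_step by blast
  ultimately show ?case using walk_step walk.walk_step[of a b "ns @ ms"] by simp
qed

text \<open>
  A change of the target from \<open>x\<close> to some \<open>a < x\<close> close to \<open>x\<close> is not noticed by a node above \<open>x\<close>.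
\<close>

definition forced where
  "forced x \<longleftrightarrow> (\<forall>b. x \<sqsubset> b \<longrightarrow> (\<exists>e. e \<sqsubset> x \<and> (\<forall>a. e \<sqsubset> a \<longrightarrow> a \<sqsubseteq> x \<longrightarrow> weight b a = weight b x)))"

text \<open>
  The weight of \<open>b\<close> towards \<open>a\<close> is found by inspecting the ladder in order; it is unchanged as long as
  \<open>a\<close> stays above the ladder points passed over on the way to \<open>x\<close>.
\<close>

lemma forcedI:
  assumes "\<And>b. x \<sqsubset> b \<Longrightarrow> \<exists>e. e \<sqsubset> x \<and> (\<forall>j\<in>underS par (weight b x). f b j \<sqsubseteq> e)"
  shows "forced x"
  unfolding forced_def
proof (intro allI impI)
  fix b assume xb: "x \<sqsubset> b"
  then obtain e where e: "e \<sqsubset> x" "\<forall>j\<in>underS par (weight b x). f b j \<sqsubseteq> e" using assms by blast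
  have "weight b a = weight b x" if a: "e \<sqsubset> a" "a \<sqsubseteq> x" for a
  proof (rule weight_eqI)
    show "a \<sqsubset> b" using leq_less_trans[OF a(2) xb] .
    show "weight b x \<in> Field par" using weight_Field[OF xb] .
    show "a \<sqsubseteq> f b (weight b x)" using leq_trans[OF a(2) leq_step[OF xb]] .
    show "f b j \<sqsubset> a" if "j \<in> underS par (weight b x)" for j
      using leq_less_trans[OF _ a(1)] e(2) that by blast
  qed
  then show "\<exists>e. e \<sqsubset> x \<and> (\<forall>a. e \<sqsubset> a \<longrightarrow> a \<sqsubseteq> x \<longrightarrow> weight b a = weight b x)" using e(1) by blast
qed

lemma forced_W: "x \<in> W \<Longrightarrow> forced x"
proof (rule forcedI)
  fix b assume "x \<in> W" and xb: "x \<sqsubset> b"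
  then obtain e where "e \<sqsubset> x" "\<forall>i\<in>Field par. f b i \<sqsubset> x \<longrightarrow> f b i \<sqsubseteq> e" using f_avoids by blast
  then show "\<exists>e. e \<sqsubset> x \<and> (\<forall>j\<in>underS par (weight b x). f b j \<sqsubseteq> e)"
    using below_weight[OF xb] underS_par_Field by blast
qed

lemma forced_cof_par: "cof_par x \<Longrightarrow> forced x"
proof (rule forcedI)
  fix b assume x: "cof_par x" and xb: "x \<sqsubset> b"
  show "\<exists>e. e \<sqsubset> x \<and> (\<forall>j\<in>underS par (weight b x). f b j \<sqsubseteq> e)"
    by (rule cof_par_bounds_image[OF x small_segment_par[OF weight_Field[OF xb]] below_weight[OF xb]])
qed

section \<open>Finding a stationary set on the walk\<close>

definition node_above_peak where
  "node_above_peak n a b =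
    (let ns = trace b a in ns ! (peak (map (\<lambda>v. weight v a) ns) - n))"

definition tail_family where
  "tail_family a \<longleftrightarrow> (\<forall>\<xi>\<in>Field lam. |a \<xi>| <o par \<and> (\<forall>\<alpha>\<in>a \<xi>. \<xi> \<sqsubset> \<alpha>))"

text \<open>
  The target that node selection has to meet: some rectangle of the two families is sent into \<open>X\<close>.
  Passing to larger families only makes this harder, which is what makes \<open>uniform_hits\<close> work.
\<close>

definition hits where
  "hits n X a b \<longleftrightarrow> (\<exists>\<xi> \<eta>. \<xi> \<sqsubset> \<eta> \<and> a \<xi> \<subseteq> underS lam \<eta> \<and>
     (\<forall>\<alpha>\<in>a \<xi>. \<forall>\<beta>\<in>b \<eta>. node_above_peak n \<alpha> \<beta> \<in> X))"

lemma tail_family_bound: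
  assumes "tail_family a"
  shows "\<exists>F. \<forall>\<xi>\<in>Field lam. F \<xi> \<in> Field lam \<and> (\<forall>\<alpha>\<in>a \<xi>. \<alpha> \<sqsubset> F \<xi>)"
proof -
  have "\<exists>y. y \<in> Field lam \<and> (\<forall>\<alpha>\<in>a \<xi>. \<alpha> \<sqsubset> y)" if "\<xi> \<in> Field lam" for \<xi>
  proof (rule bounded_lam)
    show "a \<xi> \<subseteq> Field lam" using assms that less_Field2 unfolding tail_family_def by blast
    show "|a \<xi>| \<le>o par" using assms that ordLess_imp_ordLeq unfolding tail_family_def by blast
  qed
  then show ?thesis by metis
qed

text \<open>
  What \<open>x \<in> W\<close> has to provide for the bottom part of the walks. Members of \<open>a\<close> are needed cofinally in
  \<open>x\<close>, because how close to \<open>x\<close> they have to be is known only after \<open>d\<close> has been chosen.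
\<close>

definition bottoms_below where
  "bottoms_below a x i \<longleftrightarrow> (\<forall>e. e \<sqsubset> x \<longrightarrow> (\<exists>\<xi>. e \<sqsubset> \<xi> \<and> \<xi> \<sqsubset> x \<and> a \<xi> \<subseteq> underS lam x \<and>
     (\<forall>\<alpha>\<in>a \<xi>. \<forall>v\<in>set (trace x \<alpha>). weight v \<alpha> \<in> underS par i)))"

lemma trace_weights_Field: "a \<sqsubset> b \<Longrightarrow> v \<in> set (trace b a) \<Longrightarrow> weight v a \<in> Field par"
  using weight_Field[OF walk_nodes[OF walk_trace]] .

text \<open>
  A cofinal set \<open>D\<close> of fewer than \<open>\<partial>\<close> ordinals below \<open>x\<close> suffices as a set of indices \<open>\<xi>\<close>. The walks
  in question are then fewer than \<open>\<partial>\<close>, and by regularity so are their weights.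
\<close>

lemma ex_bottom_bound:
  assumes a: "tail_family a" and x: "x \<in> W" and F: "\<And>\<xi> \<alpha>. \<xi> \<sqsubset> x \<Longrightarrow> \<alpha> \<in> a \<xi> \<Longrightarrow> \<alpha> \<sqsubset> x"
  shows "\<exists>i\<in>Field par. bottoms_below a x i"
proof -
  obtain D where D: "D \<subseteq> underS lam x" "|D| <o par" "\<forall>e. e \<sqsubset> x \<longrightarrow> (\<exists>d\<in>D. e \<sqsubseteq> d)"
    using W_cof[OF x] by blast
  define V where "V = (\<Union>\<xi>\<in>D. \<Union>\<alpha>\<in>a \<xi>. (\<lambda>v. weight v \<alpha>) ` set (trace x \<alpha>))"
  have "|V| <o par"
    unfolding V_def
  proof (rule small_UNION[OF D(2)], rule small_UNION)
    show "|a \<xi>| <o par" if "\<xi> \<in> D" for \<xi>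
      using a D(1) that less_Field1 unfolding tail_family_def by blast
    show "|(\<lambda>v. weight v \<alpha>) ` set (trace x \<alpha>)| <o par" for \<alpha> by (rule small_image[OF small_finite]) simp
  qed
  moreover have "V \<subseteq> Field par"
    using F D(1) trace_weights_Field unfolding V_def by blast
  ultimately obtain i where i: "i \<in> Field par" "\<forall>j\<in>V. j \<in> underS par i"
    using bounded_par[of V] by blast
  have "bottoms_below a x i"
    unfolding bottoms_below_def
  proof (intro allI impI)
    fix e assume "e \<sqsubset> x"
    then obtain e' where e': "e \<sqsubset> e'" "e' \<sqsubset> x" using W_limit[OF x] by (auto simp: limit_def)
    then obtain \<xi> where \<xi>: "\<xi> \<in> D" "e' \<sqsubseteq> \<xi>" using D(3) by blast
    have "e \<sqsubset> \<xi>" using less_leq_trans[OF e'(1) \<xi>(2)] .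
    moreover have "\<xi> \<sqsubset> x" using \<xi>(1) D(1) by blast
    moreover have "a \<xi> \<subseteq> underS lam x" using F[OF \<open>\<xi> \<sqsubset> x\<close>] by blast
    moreover have "weight v \<alpha> \<in> underS par i" if "\<alpha> \<in> a \<xi>" "v \<in> set (trace x \<alpha>)" for \<alpha> v
      using i(2) \<xi>(1) that unfolding V_def by blast
    ultimately show "\<exists>\<xi>. e \<sqsubset> \<xi> \<and> \<xi> \<sqsubset> x \<and> a \<xi> \<subseteq> underS lam x \<and>
     (\<forall>\<alpha>\<in>a \<xi>. \<forall>v\<in>set (trace x \<alpha>). weight v \<alpha> \<in> underS par i)" by blast
  qed
  then show ?thesis using i(1) by blast
qed

text \<open>
  The bound of \<open>ex_bottom_bound\<close> is a function from an unbounded subset of \<open>W\<close> into \<open>\<partial>\<close>, hence constant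
  on an unbounded set.
\<close>

lemma uniform_bottom_bound:
  assumes a: "tail_family a"
  shows "\<exists>i\<in>Field par. \<forall>y\<in>Field lam. \<exists>x\<in>W. y \<sqsubset> x \<and> bottoms_below a x i"
proof -
  obtain F where F: "\<And>\<xi>. \<xi> \<in> Field lam \<Longrightarrow> F \<xi> \<in> Field lam"
    "\<And>\<xi> \<alpha>. \<xi> \<in> Field lam \<Longrightarrow> \<alpha> \<in> a \<xi> \<Longrightarrow> \<alpha> \<sqsubset> F \<xi>"
    using tail_family_bound[OF a] by blast
  define U where "U = {x \<in> W. \<exists>i\<in>Field par. bottoms_below a x i}"
  have "\<exists>u\<in>U. y \<sqsubset> u" if y: "y \<in> Field lam" for y
  proof -
    have "\<exists>z. z \<in> Field lam \<and> F c \<sqsubset> z \<and> y \<sqsubset> z" if "c \<in> Field lam" for c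
    proof -
      have "|{F c, y}| \<le>o par" by (rule ordLess_imp_ordLeq[OF small_finite]) simp
      then show ?thesis using bounded_lam[of "{F c, y}"] F(1)[OF that] y by auto
    qed
    then obtain G where G: "\<And>c. c \<in> Field lam \<Longrightarrow> G c \<in> Field lam"
      "\<And>c. c \<in> Field lam \<Longrightarrow> F c \<sqsubset> G c" "\<And>c. c \<in> Field lam \<Longrightarrow> y \<sqsubset> G c" by metis
    obtain x where x: "x \<in> W" "limit x" "\<forall>c. c \<sqsubset> x \<longrightarrow> G c \<sqsubset> x"
      using stationary_meets_closure_points[OF W_stationary, of G] G(1) by blast
    obtain c where c: "c \<sqsubset> x" using x(2) by (auto simp: limit_def)
    have "y \<sqsubset> x" using less_trans[OF G(3)[OF less_Field1[OF c]]] x(3) c by blast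
    moreover have "\<alpha> \<sqsubset> x" if \<xi>: "\<xi> \<sqsubset> x" "\<alpha> \<in> a \<xi>" for \<xi> \<alpha>
    proof -
      have "\<xi> \<in> Field lam" using less_Field1[OF \<xi>(1)] .
      then have "\<alpha> \<sqsubset> G \<xi>" using less_trans[OF F(2)[OF _ \<xi>(2)] G(2)] by blast
      then show ?thesis using less_trans x(3) \<xi>(1) by blast
    qed
    then have "x \<in> U" using ex_bottom_bound[OF a x(1)] x(1) unfolding U_def by blast
    ultimately show ?thesis by blast
  qed
  moreover have "\<forall>x\<in>U. \<exists>i. i \<in> Field par \<and> bottoms_below a x i" unfolding U_def by blast
  then obtain k where k: "\<And>x. x \<in> U \<Longrightarrow> k x \<in> Field par \<and> bottoms_below a x (k x)" by metis
  moreover have "k ` U \<subseteq> Field par" using k by blast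
  moreover have "|Field par| \<le>o par" using le_par_iff card_of_mono1 by blast
  ultimately obtain i where i: "i \<in> Field par" "\<forall>y\<in>Field lam. \<exists>u\<in>U. k u = i \<and> y \<sqsubset> u"
    using pigeonhole_unbounded[of U k "Field par"] by blast
  have "\<exists>x\<in>W. y \<sqsubset> x \<and> bottoms_below a x i" if "y \<in> Field lam" for y
  proof -
    obtain u where "u \<in> U" "k u = i" "y \<sqsubset> u" using i(2) \<open>y \<in> Field lam\<close> by blast
    then show ?thesis using k[of u] by (auto simp: U_def)
  qed
  then show ?thesis using i(1) by blast
qed

lemma forced_finite:
  assumes "limit x" "forced x" "finite N" "\<And>v. v \<in> N \<Longrightarrow> x \<sqsubset> v"
  shows "\<exists>e. e \<sqsubset> x \<and> (\<forall>v\<in>N. \<forall>a. e \<sqsubset> a \<longrightarrow> a \<sqsubseteq> x \<longrightarrow> weight v a = weight v x)"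
proof -
  have "\<forall>v\<in>N. \<exists>e. e \<sqsubset> x \<and> (\<forall>a. e \<sqsubset> a \<longrightarrow> a \<sqsubseteq> x \<longrightarrow> weight v a = weight v x)"
    using assms(2,4) unfolding forced_def by blast
  then obtain g where g: "\<And>v. v \<in> N \<Longrightarrow> g v \<sqsubset> x"
    "\<And>v a. v \<in> N \<Longrightarrow> g v \<sqsubset> a \<Longrightarrow> a \<sqsubseteq> x \<Longrightarrow> weight v a = weight v x" by metis
  have "g ` N \<subseteq> underS lam x" using g(1) by blast
  from limit_bounds_finite[OF assms(1) finite_imageI[OF assms(3)] this]
  obtain e where e: "e \<sqsubset> x" "\<forall>v\<in>N. g v \<sqsubseteq> e" by auto
  have "weight v a = weight v x" if "v \<in> N" "e \<sqsubset> a" "a \<sqsubseteq> x" for v a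
    using g(2)[OF that(1) leq_less_trans[OF _ that(2)] that(3)] e(2) that(1) by blast
  then show ?thesis using e(1) by blast
qed

lemma forced_small:
  assumes "cof_par x" "|N| <o par" "\<And>v. v \<in> N \<Longrightarrow> x \<sqsubset> v"
  shows "\<exists>e. e \<sqsubset> x \<and> (\<forall>v\<in>N. \<forall>a. e \<sqsubset> a \<longrightarrow> a \<sqsubseteq> x \<longrightarrow> weight v a = weight v x)"
proof -
  have "\<forall>v\<in>N. \<exists>e. e \<sqsubset> x \<and> (\<forall>a. e \<sqsubset> a \<longrightarrow> a \<sqsubseteq> x \<longrightarrow> weight v a = weight v x)"
    using forced_cof_par[OF assms(1)] assms(3) unfolding forced_def by blast
  then obtain g where g: "\<And>v. v \<in> N \<Longrightarrow> g v \<sqsubset> x"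
    "\<And>v a. v \<in> N \<Longrightarrow> g v \<sqsubset> a \<Longrightarrow> a \<sqsubseteq> x \<Longrightarrow> weight v a = weight v x" by metis
  obtain e where e: "e \<sqsubset> x" "\<forall>v\<in>N. g v \<sqsubseteq> e"
    using cof_par_bounds_image[OF assms(1,2), of g] g(1) by blast
  have "weight v a = weight v x" if "v \<in> N" "e \<sqsubset> a" "a \<sqsubseteq> x" for v a
    using g(2)[OF that(1) leq_less_trans[OF _ that(2)] that(3)] e(2) that(1) by blast
  then show ?thesis using e(1) by blast
qed

text \<open>
  The ladder points of \<open>d\<close> with index below \<open>i\<close> are fewer than \<open>\<partial> = cf d\<close>, so they are bounded below
  \<open>d\<close>; the first ladder point that reaches an \<open>x\<close> beyond their bound has index at least \<open>i\<close>.
\<close>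

lemma large_weights:
  assumes "cof_par d" "i \<in> Field par"
  shows "\<exists>e. e \<sqsubset> d \<and> (\<forall>x. e \<sqsubset> x \<longrightarrow> x \<sqsubset> d \<longrightarrow> (i, weight d x) \<in> par)"
proof -
  have "limit d" using assms(1) by (simp add: cof_par_def)
  then obtain c where c: "c \<sqsubset> d" by (auto simp: limit_def)
  obtain e where e: "e \<sqsubset> d" "\<forall>j\<in>underS par i. f d j \<sqsubseteq> e"
    using cof_par_bounds_image[OF assms(1) small_segment_par[OF assms(2)], of "f d"]
      f_below[OF underS_par_Field c] by blast
  have "(i, weight d x) \<in> par" if x: "e \<sqsubset> x" "x \<sqsubset> d" for x
  proof (rule ccontr)
    assume neg: "\<not> ?thesis"
    then have "weight d x \<in> underS par i"
      using wo_rel.TOTALS[OF wor_par] weight_Field[OF x(2)] assms(2) par_refl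
      by (auto simp: underS_def)
    then have "x \<sqsubseteq> e" using leq_trans[OF leq_step[OF x(2)]] e(2) by blast
    then show False using leq_less_trans[OF _ x(1)] less_irrefl by blast
  qed
  then show ?thesis using e(1) by blast
qed

text \<open>
  The heart of the proof. The walks are split as \<open>T @ M @ K\<close>, from \<open>\<beta> \<in> b d\<close> to \<open>d\<close>, from \<open>d\<close> to \<open>x\<close> and
  from \<open>x\<close> to \<open>\<alpha> \<in> a \<xi>\<close>. The choices are made in the order \<open>i\<close> (bound for \<open>K\<close>), \<open>d\<close>, \<open>k\<close> (bound for \<open>T\<close> and
  for \<open>i\<close>), \<open>x\<close>, \<open>\<xi>\<close>: only so can \<open>x\<close> be taken so close to \<open>d\<close> that \<open>M\<close>, which begins with \<open>d\<close>, outweighs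
  both \<open>T\<close> and \<open>K\<close>. Then the first peak lies in \<open>M\<close>, and neither \<open>M\<close> nor its weights depend on \<open>\<alpha>\<close> and
  \<open>\<beta>\<close>.
\<close>

lemma node_above_peak_hits:
  assumes X: "stationary lam X" "\<And>d. d \<in> X \<Longrightarrow> cof_par d"
    and a: "tail_family a" and b: "tail_family b"
  shows "\<exists>n. hits n X a b"
proof -
  obtain i where i: "i \<in> Field par" "\<forall>y\<in>Field lam. \<exists>x\<in>W. y \<sqsubset> x \<and> bottoms_below a x i"
    using uniform_bottom_bound[OF a] by blast
  define U where "U = {x \<in> W. bottoms_below a x i}"
  have "U \<subseteq> Field lam" using W_limit by (auto simp: U_def limit_def)
  moreover have "\<exists>u\<in>U. y \<sqsubset> u" if "y \<in> Field lam" for y using i(2) that unfolding U_def by blast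
  ultimately obtain d where d: "d \<in> X" "limit d" "\<forall>e. e \<sqsubset> d \<longrightarrow> (\<exists>u\<in>U. e \<sqsubset> u \<and> u \<sqsubset> d)"
    using limit_points_of_unbounded[OF X(1), of U] by blast
  have dF: "d \<in> Field lam" using d(2) by (simp add: limit_def)
  have cd: "cof_par d" using X(2)[OF d(1)] .
  define N where "N = (\<Union>\<beta>\<in>b d. set (trace \<beta> d))"
  have bd: "|b d| <o par" "\<And>\<beta>. \<beta> \<in> b d \<Longrightarrow> d \<sqsubset> \<beta>" using b dF by (auto simp: tail_family_def)
  have N: "|N| <o par"
    unfolding N_def by (rule small_UNION[OF bd(1) small_finite]) simp
  have Nd: "d \<sqsubset> v" if "v \<in> N" for v using that bd(2) walk_nodes[OF walk_trace] unfolding N_def by blast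
  \<comment> \<open>Beyond \<open>e1\<close> the top walks pass through \<open>d\<close>; beyond \<open>e2\<close> the weight of \<open>d\<close> is at least \<open>k\<close>.\<close>
  obtain e1 where e1: "e1 \<sqsubset> d"
    "\<And>v \<alpha>. v \<in> N \<Longrightarrow> e1 \<sqsubset> \<alpha> \<Longrightarrow> \<alpha> \<sqsubseteq> d \<Longrightarrow> weight v \<alpha> = weight v d"
    using forced_small[OF cd N Nd] by blast
  have "|\<Union>Y\<in>{(\<lambda>v. weight v d) ` N, {i}}. Y| <o par"
  proof (rule small_UNION)
    show "|{(\<lambda>v. weight v d) ` N, {i}}| <o par" by (rule small_finite) simp
    show "|Y| <o par" if "Y \<in> {(\<lambda>v. weight v d) ` N, {i}}" for Y
      using that small_image[OF N] small_finite[of "{i}"] by auto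
  qed
  moreover have "(\<Union>Y\<in>{(\<lambda>v. weight v d) ` N, {i}}. Y) \<subseteq> Field par"
    using i(1) weight_Field[OF Nd] by auto
  ultimately obtain k where k: "k \<in> Field par"
    "\<forall>j\<in>(\<Union>Y\<in>{(\<lambda>v. weight v d) ` N, {i}}. Y). j \<in> underS par k" using bounded_par by blast
  have ik: "i \<in> underS par k" and Nk: "\<And>v. v \<in> N \<Longrightarrow> weight v d \<in> underS par k" using k(2) by auto
  obtain e2 where e2: "e2 \<sqsubset> d" "\<And>x. e2 \<sqsubset> x \<Longrightarrow> x \<sqsubset> d \<Longrightarrow> (k, weight d x) \<in> par"
    using large_weights[OF cd k(1)] by blast
  obtain e where e: "e \<sqsubset> d" "e1 \<sqsubseteq> e" "e2 \<sqsubseteq> e"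
    using limit_bounds_finite[OF d(2), of "{e1, e2}"] e1(1) e2(1) by auto
  obtain x where x: "x \<in> W" "bottoms_below a x i" "e \<sqsubset> x" "x \<sqsubset> d" using d(3) e(1) unfolding U_def by blast
  define M where "M = trace d x"
  have walkM: "walk d x M" unfolding M_def by (rule walk_trace[OF x(4)])
  have Mx: "x \<sqsubset> v" if "v \<in> set M" for v using walk_nodes[OF walkM that] .
  have hdM: "M \<noteq> []" "M ! 0 = d" using walkM x(4) less_irrefl by (auto elim: walk.cases)
  have kd: "(k, weight d x) \<in> par" using e2(2)[OF leq_less_trans[OF e(3) x(3)] x(4)] .
  \<comment> \<open>Beyond \<open>e3\<close> the walk from \<open>d\<close> passes through \<open>x\<close>.\<close>
  obtain e3 where e3: "e3 \<sqsubset> x"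
    "\<And>v \<alpha>. v \<in> set M \<Longrightarrow> e3 \<sqsubset> \<alpha> \<Longrightarrow> \<alpha> \<sqsubseteq> x \<Longrightarrow> weight v \<alpha> = weight v x"
    using forced_finite[OF W_limit[OF x(1)] forced_W[OF x(1)] finite_set Mx] by blast
  obtain e4 where e4: "e4 \<sqsubset> x" "e \<sqsubseteq> e4" "e3 \<sqsubseteq> e4"
    using limit_bounds_finite[OF W_limit[OF x(1)], of "{e, e3}"] x(3) e3(1) by auto
  obtain \<xi> where \<xi>: "e4 \<sqsubset> \<xi>" "\<xi> \<sqsubset> x" "a \<xi> \<subseteq> underS lam x"
    "\<And>\<alpha> v. \<alpha> \<in> a \<xi> \<Longrightarrow> v \<in> set (trace x \<alpha>) \<Longrightarrow> weight v \<alpha> \<in> underS par i"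
    using x(2) e4(1) unfolding bottoms_below_def by blast
  define n where "n = peak (map (\<lambda>v. weight v x) M)"
  have "node_above_peak n \<alpha> \<beta> = d" if \<alpha>: "\<alpha> \<in> a \<xi>" and \<beta>: "\<beta> \<in> b d" for \<alpha> \<beta>
  proof -
    have "\<xi> \<sqsubset> \<alpha>" using a \<alpha> less_Field1[OF \<xi>(2)] by (auto simp: tail_family_def)
    then have e4\<alpha>: "e4 \<sqsubset> \<alpha>" using less_trans[OF \<xi>(1)] by blast
    have \<alpha>x: "\<alpha> \<sqsubset> x" using \<xi>(3) \<alpha> by blast
    have \<alpha>d: "\<alpha> \<sqsubset> d" using less_trans[OF \<alpha>x x(4)] .
    define T where "T = trace \<beta> d"
    define K where "K = trace x \<alpha>"
    have TN: "set T \<subseteq> N" using \<beta> unfolding T_def N_def by blast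
    have wT: "weight v \<alpha> = weight v d" if "v \<in> set T" for v
      using e1(2)[OF _ leq_less_trans[OF leq_trans[OF e(2) e4(2)] e4\<alpha>] less_leq[OF \<alpha>d]] TN that by blast
    have wM: "weight v \<alpha> = weight v x" if "v \<in> set M" for v
      using e3(2)[OF that leq_less_trans[OF e4(3) e4\<alpha>] less_leq[OF \<alpha>x]] .
    have walkMK: "walk d \<alpha> (M @ K)" unfolding K_def
      by (rule walk_append[OF walkM wM \<alpha>x walk_trace[OF \<alpha>x]])
    have "walk \<beta> \<alpha> (T @ M @ K)"
      by (rule walk_append[OF walk_trace[OF bd(2)[OF \<beta>], folded T_def] wT \<alpha>d walkMK])
    then have tr: "trace \<beta> \<alpha> = T @ M @ K" by (rule trace_eqI)
    have eqM: "map (\<lambda>v. weight v \<alpha>) M = map (\<lambda>v. weight v x) M" using wM by simp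
    have "peak (map (\<lambda>v. weight v \<alpha>) T @ map (\<lambda>v. weight v x) M @ map (\<lambda>v. weight v \<alpha>) K)
      = length (map (\<lambda>v. weight v \<alpha>) T) + n"
      unfolding n_def
    proof (rule peak_append)
      show "set (map (\<lambda>v. weight v x) M) \<subseteq> Field par" using weight_Field[OF Mx] by auto
      have "d \<in> set M" using hdM nth_mem[of 0 M] by simp
      then show "weight d x \<in> set (map (\<lambda>v. weight v x) M)" by simp
      fix t assume "t \<in> set (map (\<lambda>v. weight v \<alpha>) T) \<union> set (map (\<lambda>v. weight v \<alpha>) K)"
      then have "t \<in> underS par k \<or> t \<in> underS par i"
        using wT Nk TN \<xi>(4)[OF \<alpha>] unfolding K_def by fastforce
      moreover have "t \<in> underS par k" if "t \<in> underS par i"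
        using par_less_trans[OF that] ik by (auto simp: underS_def)
      ultimately show "t \<in> underS par (weight d x)" using par_less_trans[OF _ kd] by blast
    qed
    then have "peak (map (\<lambda>v. weight v \<alpha>) (trace \<beta> \<alpha>)) = length T + n"
      unfolding tr map_append eqM by simp
    then show ?thesis unfolding node_above_peak_def Let_def tr using hdM by (simp add: nth_append)
  qed
  moreover have "a \<xi> \<subseteq> underS lam d" using \<xi>(3) less_trans[OF _ x(4)] by blast
  ultimately have "hits n X a b"
    unfolding hits_def using less_trans[OF \<xi>(2) x(4)] d(1) by (intro exI[of _ \<xi>] exI[of _ d]) simp
  then show ?thesis by blast
qed

text \<open>
  Given a counterexample for every \<open>n\<close>, the union of the countably many families is again a family of
  sets of size \<open>< \<partial>\<close>, and it would contradict \<open>node_above_peak_hits\<close>.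
\<close>

lemma uniform_hits:
  assumes "stationary lam X" "\<And>d. d \<in> X \<Longrightarrow> cof_par d"
  shows "\<exists>n. \<forall>a b. tail_family a \<longrightarrow> tail_family b \<longrightarrow> hits n X a b"
proof (rule ccontr)
  assume "\<not> ?thesis"
  then have "\<forall>n. \<exists>p. tail_family (fst p) \<and> tail_family (snd p) \<and> \<not> hits n X (fst p) (snd p)"
    by auto
  from choice[OF this] obtain p where
    p: "\<forall>n. tail_family (fst (p n)) \<and> tail_family (snd (p n)) \<and> \<not> hits n X (fst (p n)) (snd (p n))" ..
  define a b where "a n = fst (p n)" and "b n = snd (p n)" for n
  have ab: "\<And>n. tail_family (a n)" "\<And>n. tail_family (b n)" "\<And>n. \<not> hits n X (a n) (b n)"
    using p by (simp_all add: a_def b_def)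
  have union: "tail_family (\<lambda>\<xi>. \<Union>n::nat. c n \<xi>)" if c: "\<And>n. tail_family (c n)" for c
    unfolding tail_family_def
  proof (intro ballI conjI)
    fix \<xi> assume \<xi>: "\<xi> \<in> Field lam"
    show "|\<Union>n. c n \<xi>| <o par"
      by (rule small_UNION[OF small_countable]) (use c \<xi> in \<open>simp add: tail_family_def\<close>)
    show "\<xi> \<sqsubset> \<alpha>" if "\<alpha> \<in> (\<Union>n. c n \<xi>)" for \<alpha> using that c \<xi> unfolding tail_family_def by blast
  qed
  obtain n where "hits n X (\<lambda>\<xi>. \<Union>n. a n \<xi>) (\<lambda>\<xi>. \<Union>n. b n \<xi>)"
    using node_above_peak_hits[OF assms(1) _ union[of a, OF ab(1)] union[of b, OF ab(2)]] assms(2)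
    by blast
  then obtain \<xi> \<eta> where "\<xi> \<sqsubset> \<eta>" "(\<Union>n. a n \<xi>) \<subseteq> underS lam \<eta>"
    "\<forall>\<alpha>\<in>\<Union>n. a n \<xi>. \<forall>\<beta>\<in>\<Union>n. b n \<eta>. node_above_peak n \<alpha> \<beta> \<in> X"
    unfolding hits_def by (elim exE conjE)
  then have "\<xi> \<sqsubset> \<eta> \<and> a n \<xi> \<subseteq> underS lam \<eta> \<and> (\<forall>\<alpha>\<in>a n \<xi>. \<forall>\<beta>\<in>b n \<eta>. node_above_peak n \<alpha> \<beta> \<in> X)"
    by auto
  then have "hits n X (a n) (b n)" unfolding hits_def by (intro exI)
  then show False using ab(3) by blast
qed

section \<open>The colouring\<close>

text \<open>
  Unboundedly many columns of the Ulam matrix agree both on the row \<open>i\<close> of a stationary entry and on the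
  number \<open>n\<close> that works for this entry. Enumerated by \<open>\<lambda>\<close>, they are the colours.
\<close>

lemma strong_colouring:
  "\<exists>c :: 'a \<Rightarrow> 'a \<Rightarrow> 'a. (\<forall>u v. c u v \<in> Field lam) \<and>
    (\<forall>a b. \<forall>\<gamma>\<in>Field lam. tail_family a \<longrightarrow> tail_family b \<longrightarrow>
      (\<exists>\<xi> \<eta>. \<xi> \<sqsubset> \<eta> \<and> a \<xi> \<subseteq> underS lam \<eta> \<and> (\<forall>\<alpha>\<in>a \<xi>. \<forall>\<beta>\<in>b \<eta>. c \<alpha> \<beta> = \<gamma>)))"
proof -
  obtain A :: "'b \<Rightarrow> 'a \<Rightarrow> 'a set" where A: "\<And>i a. A i a \<subseteq> {d. cof_par d}"
    "\<And>i a b. a \<noteq> b \<Longrightarrow> A i a \<inter> A i b = {}"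
    "\<And>a. a \<in> Field lam \<Longrightarrow> \<exists>i\<in>Field par. stationary lam (A i a)"
    using ulam_matrix[OF stationary_cof_par] by blast
  define P where "P p a \<longleftrightarrow> (\<forall>f g. tail_family f \<longrightarrow> tail_family g \<longrightarrow> hits (snd p) (A (fst p) a) f g)"
    for p a
  have "\<exists>p. p \<in> Field par \<times> UNIV \<and> P p a" if a: "a \<in> Field lam" for a
  proof -
    obtain i where i: "i \<in> Field par" "stationary lam (A i a)" using A(3)[OF a] by blast
    then obtain n where "\<forall>f g. tail_family f \<longrightarrow> tail_family g \<longrightarrow> hits n (A i a) f g"
      using uniform_hits[OF i(2)] A(1) by blast
    then show ?thesis using i(1) unfolding P_def by (intro exI[of _ "(i, n)"]) simp
  qed
  then obtain p where p: "\<And>a. a \<in> Field lam \<Longrightarrow> p a \<in> Field par \<times> UNIV"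
    "\<And>a. a \<in> Field lam \<Longrightarrow> P (p a) a" by metis
  have "|Field par \<times> (UNIV :: nat set)| \<le>o par"
  proof (rule card_of_Times_ordLeq_infinite_Field)
    show "infinite (Field par)" using par_inf by (simp add: cinfinite_def)
    show "|Field par| \<le>o par" using le_par_iff card_of_mono1 by blast
    show "|UNIV :: nat set| \<le>o par" by (rule ordLess_imp_ordLeq[OF small_countable])
  qed (rule Card_par)
  moreover have "p ` Field lam \<subseteq> Field par \<times> (UNIV :: nat set)" using p(1) by blast
  moreover have "\<exists>u\<in>Field lam. a \<sqsubset> u" if "a \<in> Field lam" for a using ex_greater[OF that] less_Field2 by blast
  ultimately obtain q where q: "\<forall>a\<in>Field lam. \<exists>u\<in>Field lam. p u = q \<and> a \<sqsubset> u"
    using pigeonhole_unbounded[of "Field lam" p "Field par \<times> UNIV"] by blast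
  obtain i n where qin: "q = (i, n)" by (cases q)
  define Z where "Z = {a \<in> Field lam. p a = q}"
  have Z: "hits n (A i a) f g" if "a \<in> Z" "tail_family f" "tail_family g" for a f g
    using p(2)[of a] that by (auto simp: Z_def qin P_def)
  have "cofinal Z lam" using q unfolding cofinal_def Z_def by (fastforce simp: underS_def)
  then have "|Z| =o lam" using lam_reg by (simp add: regularCard_def Z_def)
  then have "|Z| =o |Field lam|"
    by (rule ordIso_transitive[OF _ ordIso_symmetric[OF card_of_Field_ordIso[OF Card_lam]]])
  then obtain h where h: "bij_betw h Z (Field lam)" unfolding card_of_ordIso[symmetric] by blast
  obtain l0 where l0: "l0 \<in> Field lam" using lam_inf by (fastforce simp: cinfinite_def)
  \<comment> \<open>Disjointness within row \<open>i\<close> makes the column unique; \<open>l0\<close> is an arbitrary default colour.\<close>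
  define c where "c u v = (if \<exists>a\<in>Z. node_above_peak n u v \<in> A i a
    then h (THE a. a \<in> Z \<and> node_above_peak n u v \<in> A i a) else l0)" for u v
  have c: "c u v = h a" if "a \<in> Z" "node_above_peak n u v \<in> A i a" for u v a
  proof -
    have "(THE a. a \<in> Z \<and> node_above_peak n u v \<in> A i a) = a"
      by (rule the_equality) (use that A(2) in blast)+
    then show ?thesis using that unfolding c_def by auto
  qed
  have "c u v \<in> Field lam" for u v
  proof (cases "\<exists>a\<in>Z. node_above_peak n u v \<in> A i a")
    case True
    then obtain a where "a \<in> Z" "node_above_peak n u v \<in> A i a" by blast
    then show ?thesis using c h bij_betwE by metis
  next
    case False
    then show ?thesis using l0 by (simp add: c_def)
  qed
  moreover have "\<exists>\<xi> \<eta>. \<xi> \<sqsubset> \<eta> \<and> f \<xi> \<subseteq> underS lam \<eta> \<and> (\<forall>\<alpha>\<in>f \<xi>. \<forall>\<beta>\<in>g \<eta>. c \<alpha> \<beta> = \<gamma>)"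
    if \<gamma>: "\<gamma> \<in> Field lam" and fg: "tail_family f" "tail_family g" for f g \<gamma>
  proof -
    obtain a where a: "a \<in> Z" "h a = \<gamma>" using h \<gamma> by (metis bij_betw_imp_surj_on imageE)
    show ?thesis using Z[OF a(1) fg] c[OF a(1)] a(2) unfolding hits_def by blast
  qed
  ultimately show ?thesis by blast
qed

text \<open>
  The two sequences are reindexed as families climbing up \<open>\<lambda>\<close>: \<open>a \<xi>\<close> is the row \<open>p \<xi>\<close> of the first sequence,
  \<open>b \<eta>\<close> the row \<open>q \<eta>\<close> of the second. Choosing \<open>q \<eta>\<close> above all \<open>p \<xi>\<close> with \<open>\<xi> < \<eta>\<close> yields the required order
  of the row indices.
\<close>

lemma Pr1_lam: "Pr1 lam lam lam par"
proof -
  from strong_colouring obtain c :: "'a \<Rightarrow> 'a \<Rightarrow> 'a" where c: "\<forall>u v. c u v \<in> Field lam"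
    "\<forall>a b. \<forall>\<gamma>\<in>Field lam. tail_family a \<longrightarrow> tail_family b \<longrightarrow>
      (\<exists>\<xi> \<eta>. \<xi> \<sqsubset> \<eta> \<and> a \<xi> \<subseteq> underS lam \<eta> \<and> (\<forall>\<alpha>\<in>a \<xi>. \<forall>\<beta>\<in>b \<eta>. c \<alpha> \<beta> = \<gamma>))"
    by (elim exE conjE)
  define C where "C A = (THE z. \<exists>u v. A = {u, v} \<and> u \<sqsubset> v \<and> z = c u v)" for A
  have C: "C {u, v} = c u v" if "u \<sqsubset> v" for u v
    unfolding C_def
  proof (rule the_equality)
    show "\<exists>u' v'. {u, v} = {u', v'} \<and> u' \<sqsubset> v' \<and> c u v = c u' v'" using that by blast
    fix z assume "\<exists>u' v'. {u, v} = {u', v'} \<and> u' \<sqsubset> v' \<and> z = c u' v'"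
    then show "z = c u v"
      using that less_trans[of u v u] less_irrefl by (auto simp: doubleton_eq_iff)
  qed
  have "C A \<in> Field lam" if A: "A \<in> nsets (Field lam) 2" for A
  proof -
    obtain u v where uv: "A = {u, v}" "u \<noteq> v" "u \<in> Field lam" "v \<in> Field lam"
      using A by (auto simp: nsets_def card_2_iff)
    then consider "u \<sqsubset> v" | "v \<sqsubset> u" using not_less[of u v] leq_iff[of v u] by blast
    then show ?thesis using C[of u v] C[of v u] c(1) uv(1) by (cases; simp add: insert_commute)
  qed
  then have "C \<in> nsets (Field lam) 2 \<rightarrow> Field lam" by blast
  moreover have "\<exists>\<alpha>1\<in>Field lam. \<exists>\<alpha>0\<in>underS lam \<alpha>1. \<forall>j0\<in>underS par i0. \<forall>j1\<in>underS par i1.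
      C {\<zeta>0 (\<alpha>0, j0), \<zeta>1 (\<alpha>1, j1)} = \<gamma> \<and> \<zeta>0 (\<alpha>0, j0) \<sqsubset> \<zeta>1 (\<alpha>1, j1)"
    if i: "i0 \<in> Field par" "i1 \<in> Field par" and \<gamma>: "\<gamma> \<in> Field lam"
      and z0: "\<zeta>0 \<in> Field lam \<times> underS par i0 \<rightarrow> Field lam" "inj_on \<zeta>0 (Field lam \<times> underS par i0)"
      and z1: "\<zeta>1 \<in> Field lam \<times> underS par i1 \<rightarrow> Field lam" "inj_on \<zeta>1 (Field lam \<times> underS par i1)"
    for i0 i1 \<gamma> and \<zeta>0 \<zeta>1 :: "'a \<times> 'b \<Rightarrow> 'a"
  proof -
    have "\<exists>p. p \<in> Field lam \<and> (\<forall>j\<in>underS par i0. \<xi> \<sqsubset> \<zeta>0 (p, j))" if "\<xi> \<in> Field lam" for \<xi>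
      using injective_family_escapes[OF z0(2,1) that that] less_Field2 by blast
    then obtain p where p: "\<And>\<xi>. \<xi> \<in> Field lam \<Longrightarrow> p \<xi> \<in> Field lam"
      "\<And>\<xi> j. \<xi> \<in> Field lam \<Longrightarrow> j \<in> underS par i0 \<Longrightarrow> \<xi> \<sqsubset> \<zeta>0 (p \<xi>, j)" by metis
    have "\<exists>q. (\<forall>\<xi>\<in>underS lam \<eta>. p \<xi> \<sqsubset> q) \<and> (\<forall>j\<in>underS par i1. \<eta> \<sqsubset> \<zeta>1 (q, j))"
      if \<eta>: "\<eta> \<in> Field lam" for \<eta>
    proof -
      obtain k where k: "k \<in> Field lam" "\<forall>\<xi>\<in>underS lam \<eta>. p \<xi> \<sqsubset> k"
        using bounded_image[OF segment_small[OF \<eta>], of p] p(1)[OF less_Field1] by blast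
      obtain q where q: "k \<sqsubset> q" "\<forall>j\<in>underS par i1. \<eta> \<sqsubset> \<zeta>1 (q, j)"
        using injective_family_escapes[OF z1(2,1) \<eta> k(1)] by blast
      have "p \<xi> \<sqsubset> q" if "\<xi> \<sqsubset> \<eta>" for \<xi> using less_trans[OF _ q(1)] k(2) that by blast
      then show ?thesis using q(2) by blast
    qed
    then obtain q where q: "\<And>\<eta> \<xi>. \<eta> \<in> Field lam \<Longrightarrow> \<xi> \<sqsubset> \<eta> \<Longrightarrow> p \<xi> \<sqsubset> q \<eta>"
      "\<And>\<eta> j. \<eta> \<in> Field lam \<Longrightarrow> j \<in> underS par i1 \<Longrightarrow> \<eta> \<sqsubset> \<zeta>1 (q \<eta>, j)" by metis
    define a where "a \<xi> = (\<lambda>j. \<zeta>0 (p \<xi>, j)) ` underS par i0" for \<xi>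
    define b where "b \<eta> = (\<lambda>j. \<zeta>1 (q \<eta>, j)) ` underS par i1" for \<eta>
    have "|a \<xi>| <o par" "|b \<xi>| <o par" for \<xi>
      unfolding a_def b_def by (rule small_image[OF small_segment_par[OF i(1)]],
        rule small_image[OF small_segment_par[OF i(2)]])
    moreover have "\<xi> \<sqsubset> \<alpha>" if "\<xi> \<in> Field lam" "\<alpha> \<in> a \<xi> \<or> \<alpha> \<in> b \<xi>" for \<xi> \<alpha>
      using that p(2) q(2) by (auto simp: a_def b_def)
    ultimately have ab: "tail_family a" "tail_family b" by (auto simp: tail_family_def)
    from c(2)[rule_format, OF \<gamma> ab]
    obtain \<xi> \<eta> where h: "\<xi> \<sqsubset> \<eta>" "a \<xi> \<subseteq> underS lam \<eta>" "\<forall>\<alpha>\<in>a \<xi>. \<forall>\<beta>\<in>b \<eta>. c \<alpha> \<beta> = \<gamma>"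
      by (elim exE conjE)
    have \<eta>: "\<eta> \<in> Field lam" using less_Field2[OF h(1)] .
    have pq: "p \<xi> \<sqsubset> q \<eta>" using q(1)[OF \<eta> h(1)] .
    have "C {\<zeta>0 (p \<xi>, j0), \<zeta>1 (q \<eta>, j1)} = \<gamma> \<and> \<zeta>0 (p \<xi>, j0) \<sqsubset> \<zeta>1 (q \<eta>, j1)"
      if j: "j0 \<in> underS par i0" "j1 \<in> underS par i1" for j0 j1
    proof -
      have 0: "\<zeta>0 (p \<xi>, j0) \<in> a \<xi>" using j(1) by (simp add: a_def)
      have 1: "\<zeta>1 (q \<eta>, j1) \<in> b \<eta>" using j(2) by (simp add: b_def)
      have "\<zeta>0 (p \<xi>, j0) \<sqsubset> \<zeta>1 (q \<eta>, j1)" using less_trans[OF _ q(2)[OF \<eta> j(2)]] h(2) 0 by blast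
      then show ?thesis using C h(3) 0 1 by simp
    qed
    then show ?thesis using pq less_Field2[OF pq] by blast
  qed
  ultimately show ?thesis unfolding Pr1_pair_def by (intro bexI[of _ C]) simp_all
qed

end

lemma Pr1_pair_fewer_colours:
  assumes "Pr1_pair lam mu sig th0 th1" "Field tau \<noteq> {}" "|Field tau| \<le>o |Field sig|"
  shows "Pr1_pair lam mu tau th0 th1"
proof -
  from card_of_ordLeq2[OF assms(2), THEN iffD2, OF assms(3)]
  obtain h where h: "h ` Field sig = Field tau" by blast
  from assms(1) obtain c where c: "c \<in> nsets (Field lam) 2 \<rightarrow> Field sig"
    "\<forall>i0\<in>Field th0. \<forall>i1\<in>Field th1. \<forall>\<zeta>0 \<zeta>1. \<forall>\<gamma>\<in>Field sig.
          \<zeta>0 \<in> Field mu \<times> underS th0 i0 \<rightarrow> Field lam \<and>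
          \<zeta>1 \<in> Field mu \<times> underS th1 i1 \<rightarrow> Field lam \<and>
          inj_on \<zeta>0 (Field mu \<times> underS th0 i0) \<and>
          inj_on \<zeta>1 (Field mu \<times> underS th1 i1) \<and>
          \<zeta>0 ` (Field mu \<times> underS th0 i0) \<inter> \<zeta>1 ` (Field mu \<times> underS th1 i1) = {} \<longrightarrow>
          (\<exists>\<alpha>1\<in>Field mu. \<exists>\<alpha>0\<in>underS mu \<alpha>1.
                \<forall>j0\<in>underS th0 i0. \<forall>j1\<in>underS th1 i1.
                  c {\<zeta>0 (\<alpha>0, j0), \<zeta>1 (\<alpha>1, j1)} = \<gamma> \<and>
                  \<zeta>0 (\<alpha>0, j0) \<in> underS lam (\<zeta>1 (\<alpha>1, j1)))"
    unfolding Pr1_pair_def by (elim bexE)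
  show ?thesis
    unfolding Pr1_pair_def
  proof (intro bexI[of _ "h \<circ> c"] ballI allI impI)
    show "h \<circ> c \<in> nsets (Field lam) 2 \<rightarrow> Field tau" using c(1) h[symmetric] by (simp add: Pi_iff)
    fix i0 i1 \<zeta>0 \<zeta>1 \<gamma>
    assume "i0 \<in> Field th0" "i1 \<in> Field th1" and \<gamma>: "\<gamma> \<in> Field tau"
      and z: "\<zeta>0 \<in> Field mu \<times> underS th0 i0 \<rightarrow> Field lam \<and>
          \<zeta>1 \<in> Field mu \<times> underS th1 i1 \<rightarrow> Field lam \<and>
          inj_on \<zeta>0 (Field mu \<times> underS th0 i0) \<and>
          inj_on \<zeta>1 (Field mu \<times> underS th1 i1) \<and>
          \<zeta>0 ` (Field mu \<times> underS th0 i0) \<inter> \<zeta>1 ` (Field mu \<times> underS th1 i1) = {}"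
    have "\<gamma> \<in> h ` Field sig" using \<gamma> by (simp only: h)
    then obtain g where g: "g \<in> Field sig" "h g = \<gamma>" by (elim imageE) simp
    from c(2)[rule_format, OF \<open>i0 \<in> Field th0\<close> \<open>i1 \<in> Field th1\<close> g(1) z]
    obtain \<alpha>1 \<alpha>0 where "\<alpha>1 \<in> Field mu" "\<alpha>0 \<in> underS mu \<alpha>1"
      "\<forall>j0\<in>underS th0 i0. \<forall>j1\<in>underS th1 i1. c {\<zeta>0 (\<alpha>0, j0), \<zeta>1 (\<alpha>1, j1)} = g \<and>
         \<zeta>0 (\<alpha>0, j0) \<in> underS lam (\<zeta>1 (\<alpha>1, j1))"
      by (elim bexE)
    with g(2)
    show "\<exists>\<alpha>1\<in>Field mu. \<exists>\<alpha>0\<in>underS mu \<alpha>1.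
                \<forall>j0\<in>underS th0 i0. \<forall>j1\<in>underS th1 i1.
                  (h \<circ> c) {\<zeta>0 (\<alpha>0, j0), \<zeta>1 (\<alpha>1, j1)} = \<gamma> \<and>
                  \<zeta>0 (\<alpha>0, j0) \<in> underS lam (\<zeta>1 (\<alpha>1, j1))"
      by (intro bexI[of _ \<alpha>1] bexI[of _ \<alpha>0]) simp_all
  qed
qed

theorem theorem1p1:
  fixes lam :: "'a rel" and par :: "'b rel" and W :: "'a set"
  assumes "Cinfinite lam" and "Cinfinite par"
    and "lam =o cardSuc par"
    and "regularCard par" and "natLeq <o par"
    and "stationary lam W"
    and "\<forall>\<delta>\<in>W. cofinality (seg lam \<delta>) <o par"
    and "\<forall>\<delta>\<in>Field lam. \<not> reflects_in lam W \<delta>"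
  shows "Pr1 lam lam par par \<and> Pr1 lam lam lam par"
proof -
  interpret successor_of_regular lam par by (intro successor_of_regular.intro assms(1-5))
  from ladder_function[OF assms(8)] obtain f where
    f: "\<forall>b i a. i \<in> Field par \<longrightarrow> a \<in> underS lam b \<longrightarrow> f b i \<in> underS lam b"
      "\<forall>a b. a \<in> underS lam b \<longrightarrow> (\<exists>i\<in>Field par. (a, f b i) \<in> lam)"
      "\<forall>x\<in>W. \<forall>b. limit x \<longrightarrow> x \<in> underS lam b \<longrightarrow>
        (\<exists>e. e \<in> underS lam x \<and> (\<forall>i\<in>Field par. f b i \<in> underS lam x \<longrightarrow> (f b i, e) \<in> lam))"
    by (elim exE conjE)
  have W_cof: "\<exists>D. D \<subseteq> underS lam x \<and> |D| <o par \<and> (\<forall>a. a \<in> underS lam x \<longrightarrow> (\<exists>d\<in>D. (a, d) \<in> lam))"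
    if x: "x \<in> W" for x
  proof -
    have "Well_order (seg lam x)" unfolding seg_def by (rule Well_order_Restr[OF wo])
    then obtain D where D: "unbounded (seg lam x) D" "cofinality (seg lam x) = |D|"
      using cofinality_attained by blast
    have "|D| <o par" using assms(7) x D(2) by metis
    then show ?thesis using D(1) unfolding unbounded_seg by blast
  qed
  interpret ladder_system lam par "{x \<in> W. limit x}" f
  proof unfold_locales
    show "stationary lam {x \<in> W. limit x}" by (rule stationary_limits[OF assms(6)])
    show "\<exists>D. D \<subseteq> underS lam x \<and> |D| <o par \<and> (\<forall>a. a \<in> underS lam x \<longrightarrow> (\<exists>d\<in>D. (a, d) \<in> lam))"
      if "x \<in> {x \<in> W. limit x}" for x
      using W_cof that by simp
    show "\<exists>e. e \<in> underS lam x \<and> (\<forall>i\<in>Field par. f b i \<in> underS lam x \<longrightarrow> (f b i, e) \<in> lam)"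
      if "x \<in> {x \<in> W. limit x}" "x \<in> underS lam b" for x b
      using f(3)[rule_format, OF _ _ that(2)] that(1) by simp
    show "f b i \<in> underS lam b" if "i \<in> Field par" "a \<in> underS lam b" for i a b
      using f(1)[rule_format, OF that] .
    show "\<exists>i\<in>Field par. (a, f b i) \<in> lam" if "a \<in> underS lam b" for a b
      using f(2)[rule_format, OF that] .
  qed simp
  have "Field par \<noteq> {}" using assms(2) by (auto simp: cinfinite_def)
  moreover have "|Field par| \<le>o |Field lam|"
    by (rule ordIso_ordLeq_trans[OF card_of_Field_ordIso[OF Card_par]
          ordLeq_ordIso_trans[OF ordLess_imp_ordLeq[OF par_less_lam]
            ordIso_symmetric[OF card_of_Field_ordIso[OF Card_lam]]]])
  ultimately have "Pr1 lam lam par par" by (rule Pr1_pair_fewer_colours[OF Pr1_lam])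
  then show ?thesis using Pr1_lam by (rule conjI)
qed

end
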